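(* Let $(\Gamma_1,\Gamma_2,\Gamma_3,\Gamma_4)$ be a cycle-free $4$-partition of the complete graph $K_8$ such that $\Gamma_4$ is isomorphic to the tree $T_{19}$. Then $(\Gamma_1,\Gamma_2,\Gamma_3,\Gamma_4)$ is weakly equivalent to a cycle-free $4$-partition $(\Delta_1,\Delta_2,\Delta_3,\Delta_4)$ of $K_8$ such that $\Delta_4$ is isomorphic to the twin-star graph $TS_4$.
   Context: All graphs are simple and undirected; $(i,j)$ and $(j,i)$ denote the same edge. $K_n$ is the complete graph on $\{1,\dots,n\}$. A $d$-partition of $K_n$ is an ordered tuple $(\Gamma_1,\dots,\Gamma_d)$ of subgraphs of $K_n$, each with vertex set $\{1,\dots,n\}$, whose edge sets are pairwise disjoint and have union $E(K_n)$. It is cycle-free if no $\Gamma_i$ contains a cycle. $\mathcal{P}_d^{cf}(K_{2d})$ is the set of cycle-free $d$-partitions of $K_{2d}$ (here $d=4$). Involutions: it is known that for every $\mathcal{P}\in\mathcal{P}_d^{cf}(K_{2d})$ and distinct vertices $x,y,z$ there is a unique $\mathcal{Q}\in\mathcal{P}_d^{cf}(K_{2d})$ such that $\mathcal{P}$ and $\mathcal{Q}$ coincide (assign the edge to the component of the same index) on every edge of $K_{2d}$ other than $(x,y),(x,z),(y,z)$, and differ on at least two of these three edges. This $\mathcal{Q}$ is denoted $\mathcal{P}^{(x,y,z)}$. Action of $S_{2d}\times S_d$: for $\sigma\in S_{2d}$, $\sigma\circ(\Gamma_1,\dots,\Gamma_d)=(\sigma\circ\Gamma_1,\dots,\sigma\circ\Gamma_d)$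 where $E(\sigma\circ\Gamma)=\{(\sigma(i),\sigma(j)):(i,j)\in E(\Gamma)\}$; for $\tau\in S_d$, $\tau\odot(\Gamma_1,\dots,\Gamma_d)=(\Gamma_{\tau^{-1}(1)},\dots,\Gamma_{\tau^{-1}(d)})$. These actions commute, and $(\sigma,\tau)\cdot\mathcal{P}=\sigma\circ(\tau\odot\mathcal{P})$. Weak equivalence: $\mathcal{P},\mathcal{Q}\in\mathcal{P}_d^{cf}(K_{2d})$ are weakly equivalent if there are $n\ge 0$, $\mathcal{P}_0,\dots,\mathcal{P}_n\in\mathcal{P}_d^{cf}(K_{2d})$, $1\le x_i<y_i<z_i\le 2d$ and $(\sigma_i,\tau_i)\in S_{2d}\times S_d$ ($1\le i\le n$) with $\mathcal{P}_0=\mathcal{P}$, $\mathcal{P}_n=\mathcal{Q}$ and $(\sigma_i,\tau_i)\cdot(\mathcal{P}_i^{(x_i,y_i,z_i)})=\mathcal{P}_{i-1}$ for all $1\le i\le n$. Trees on $\{1,\dots,8\}$: $T_{19}$ has edges $(1,3),(2,3),(3,4),(4,5),(4,6),(4,7),(7,8)$. $TS_4$ has edges $(1,2),(1,3),(1,5),(1,7),(2,4),(2,6),(2,8)$. *)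

theory Defs
  imports "HOL-Combinatorics.Permutations" "HOL-Library.FuncSet" "HOL-Library.Disjoint_Sets"
begin

text \<open>All graphs have the fixed vertex set \<open>{1..n}\<close>, so a graph is identified with
  its edge set, an edge being a two-element set of vertices.\<close>

definition complete_edges :: "nat \<Rightarrow> nat set set" where
  "complete_edges n = {{i, j} | i j. i \<in> {1..n} \<and> j \<in> {1..n} \<and> i \<noteq> j}"

definition is_cycle :: "nat set set \<Rightarrow> nat list \<Rightarrow> bool" where
  "is_cycle E vs \<longleftrightarrow> 3 \<le> length vs \<and> distinct vs \<and>
     (\<forall>k < length vs. {vs ! k, vs ! (Suc k mod length vs)} \<in> E)"

definition has_cycle :: "nat set set \<Rightarrow> bool" where
  "has_cycle E \<longleftrightarrow> (\<exists>vs. is_cycle E vs)"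

definition graph_isomorphic :: "nat \<Rightarrow> nat set set \<Rightarrow> nat set set \<Rightarrow> bool" where
  "graph_isomorphic n E F \<longleftrightarrow> (\<exists>f. bij_betw f {1..n} {1..n} \<and>
     (\<forall>i \<in> {1..n}. \<forall>j \<in> {1..n}. {i, j} \<in> E \<longleftrightarrow> {f i, f j} \<in> F))"

text \<open>A tuple \<open>(\<Gamma>\<^sub>1, \<dots>, \<Gamma>\<^sub>d)\<close> is a function on \<open>{1..d}\<close> that is
  \<open>undefined\<close> elsewhere, so that equality of such functions is equality of tuples.\<close>

definition partitions :: "nat \<Rightarrow> nat \<Rightarrow> (nat \<Rightarrow> nat set set) set" where
  "partitions d n = {P \<in> {1..d} \<rightarrow>\<^sub>E Pow (complete_edges n).
     disjoint_family_on P {1..d} \<and> (\<Union>i \<in> {1..d}. P i) = complete_edges n}"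

definition cf_partitions :: "nat \<Rightarrow> nat \<Rightarrow> (nat \<Rightarrow> nat set set) set" where
  "cf_partitions d n = {P \<in> partitions d n. \<forall>i \<in> {1..d}. \<not> has_cycle (P i)}"

definition coincide_on ::
    "nat \<Rightarrow> (nat \<Rightarrow> nat set set) \<Rightarrow> (nat \<Rightarrow> nat set set) \<Rightarrow> nat set \<Rightarrow> bool" where
  "coincide_on d P Q e \<longleftrightarrow> (\<forall>i \<in> {1..d}. e \<in> P i \<longleftrightarrow> e \<in> Q i)"

text \<open>For \<open>P\<close> a cycle-free \<open>d\<close>-partition of the complete graph on \<open>{1..2 * d}\<close> and
  distinct vertices \<open>x\<close>, \<open>y\<close>, \<open>z\<close>, exactly one \<open>Q\<close> is known to satisfy the condition below.\<close>

definition involution ::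
    "nat \<Rightarrow> (nat \<Rightarrow> nat set set) \<Rightarrow> nat \<Rightarrow> nat \<Rightarrow> nat \<Rightarrow> (nat \<Rightarrow> nat set set)" where
  "involution d P x y z = (THE Q. Q \<in> cf_partitions d (2 * d) \<and>
     (\<forall>e \<in> complete_edges (2 * d) - {{x, y}, {x, z}, {y, z}}. coincide_on d P Q e) \<and>
     2 \<le> card {e \<in> {{x, y}, {x, z}, {y, z}}. \<not> coincide_on d P Q e})"

definition vertex_action ::
    "nat \<Rightarrow> (nat \<Rightarrow> nat) \<Rightarrow> (nat \<Rightarrow> nat set set) \<Rightarrow> (nat \<Rightarrow> nat set set)" where
  "vertex_action d \<sigma> P = (\<lambda>i \<in> {1..d}. (\<lambda>e. \<sigma> ` e) ` P i)"

definition index_action ::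
    "nat \<Rightarrow> (nat \<Rightarrow> nat) \<Rightarrow> (nat \<Rightarrow> nat set set) \<Rightarrow> (nat \<Rightarrow> nat set set)" where
  "index_action d \<tau> P = (\<lambda>i \<in> {1..d}. P (inv \<tau> i))"

definition weakly_equivalent ::
    "nat \<Rightarrow> (nat \<Rightarrow> nat set set) \<Rightarrow> (nat \<Rightarrow> nat set set) \<Rightarrow> bool" where
  "weakly_equivalent d P Q \<longleftrightarrow>
     (\<exists>(n :: nat) (R :: nat \<Rightarrow> nat \<Rightarrow> nat set set)
        (x :: nat \<Rightarrow> nat) (y :: nat \<Rightarrow> nat) (z :: nat \<Rightarrow> nat)
        (\<sigma> :: nat \<Rightarrow> nat \<Rightarrow> nat) (\<tau> :: nat \<Rightarrow> nat \<Rightarrow> nat).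
        (\<forall>i \<in> {0..n}. R i \<in> cf_partitions d (2 * d)) \<and> R 0 = P \<and> R n = Q \<and>
        (\<forall>i \<in> {1..n}.
           1 \<le> x i \<and> x i < y i \<and> y i < z i \<and> z i \<le> 2 * d \<and>
           \<sigma> i permutes {1..2 * d} \<and> \<tau> i permutes {1..d} \<and>
           vertex_action d (\<sigma> i)
             (index_action d (\<tau> i) (involution d (R i) (x i) (y i) (z i))) = R (i - 1)))"

definition T19 :: "nat set set" where
  "T19 = {{1, 3}, {2, 3}, {3, 4}, {4, 5}, {4, 6}, {4, 7}, {7, 8}}"

definition TS4 :: "nat set set" where
  "TS4 = {{1, 2}, {1, 3}, {1, 5}, {1, 7}, {2, 4}, {2, 6}, {2, 8}}"

end

theory Submission
  imports Defs "HOL-Library.Transitive_Closure_Table"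
begin

text \<open>
  All parts of a cycle-free 4-partition of \<open>K\<^sub>8\<close> are spanning trees. If \<open>\<Gamma>\<^sub>4\<close> is a copy of \<open>T\<^sub>1\<^sub>9\<close>,
  its vertex of degree four is a leaf of the other three trees, so deleting it leaves three spanning
  trees on seven vertices, and the edges at the deleted vertex can be rearranged at will.
  Write \<open>u\<close> for the vertex of degree three, \<open>p\<close> and \<open>q\<close> for its leaves and \<open>xy\<close> for the remaining
  edge of \<open>\<Gamma>\<^sub>4\<close> on these seven vertices. Only exchanges of two adjacent edges between two of the trees
  are used; by uniqueness of the involutions, each of them is one.
  Exchanging \<open>xy\<close> for \<open>ux\<close> or \<open>uy\<close> produces \<open>TS\<^sub>4\<close>; it is possible as soon as some tree contains a
  path between \<open>x\<close> and \<open>y\<close> on which \<open>u\<close> is adjacent to an end. If this fails, first replace \<open>xy\<close>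
  by an adjacent edge avoiding \<open>u\<close>, \<open>p\<close> and \<open>q\<close>, or make \<open>p\<close> or \<open>q\<close> the new centre of the star.
  It is a finite fact that after at most one such move the final exchange is available.
\<close>

section \<open>Forests and spanning trees\<close>

definition conn :: "'a set set \<Rightarrow> 'a \<Rightarrow> 'a \<Rightarrow> bool" where
  "conn E = (\<lambda>a b. {a, b} \<in> E)\<^sup>*\<^sup>*"

lemma conn_refl [simp]: "conn E x x"
  by (simp add: conn_def)

lemma conn_edge: "{x, y} \<in> E \<Longrightarrow> conn E x y"
  unfolding conn_def by (rule r_into_rtranclp)

lemma conn_trans [trans]: "conn E x y \<Longrightarrow> conn E y z \<Longrightarrow> conn E x z"
  unfolding conn_def by (rule rtranclp_trans)

lemma conn_sym: "conn E x y \<Longrightarrow> conn E y x"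
  unfolding conn_def
proof (induction rule: rtranclp_induct)
  case (step y z)
  then have "{z, y} \<in> E" by (simp add: insert_commute)
  with step show ?case by (meson converse_rtranclp_into_rtranclp)
qed simp

lemma conn_commute: "conn E x y \<longleftrightarrow> conn E y x"
  by (blast intro: conn_sym)

lemma conn_subst:
  assumes "conn E x y" and "\<And>a b. {a, b} \<in> E \<Longrightarrow> conn E' a b"
  shows "conn E' x y"
  using assms(1) unfolding conn_def[of E]
proof (induction rule: rtranclp_induct)
  case (step y z)
  then show ?case using assms(2)[of y z] conn_trans[of E' x y z] by simp
qed simp

lemma conn_mono: "conn E x y \<Longrightarrow> E \<subseteq> E' \<Longrightarrow> conn E' x y"
  by (rule conn_subst) (auto intro: conn_edge)

text \<open>A walk can be shortened until it uses the new edge \<open>ab\<close> at most once, in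
  one of its two directions; this gives the three cases.\<close>

lemma conn_insert:
  "conn (insert {a, b} E) x y \<longleftrightarrow>
     conn E x y \<or> conn E x a \<and> conn E b y \<or> conn E x b \<and> conn E a y"
  (is "?L x y \<longleftrightarrow> ?R x y")
proof
  assume "?L x y"
  then show "?R x y"
    unfolding conn_def[of "insert _ _"]
  proof (induction rule: rtranclp_induct)
    case (step y z)
    then consider "{y, z} \<in> E" | "y = a" "z = b" | "y = b" "z = a"
      by (auto simp: doubleton_eq_iff)
    then show ?case
      using step.IH by cases (meson conn_edge conn_trans conn_refl)+
  qed simp
next
  have "?L a b" by (simp add: conn_edge)
  moreover have "conn E u w \<Longrightarrow> ?L u w" for u w
    by (rule conn_mono) auto
  moreover assume "?R x y"
  ultimately show "?L x y"
    by (meson conn_trans conn_sym)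
qed

text \<open>An edge lies on a cycle exactly when its ends stay connected without it. This trades
  vertex lists for reachability, which the counting arguments below can handle.\<close>

lemma has_cycle_iff:
  "has_cycle E \<longleftrightarrow> (\<exists>a b. a \<noteq> b \<and> {a, b} \<in> E \<and> conn (E - {{a, b}}) a b)"
proof
  assume "has_cycle E"
  then obtain vs where l: "3 \<le> length vs" and d: "distinct vs"
    and e: "\<And>k. k < length vs \<Longrightarrow> {vs ! k, vs ! (Suc k mod length vs)} \<in> E"
    unfolding has_cycle_def is_cycle_def by blast
  define n where "n = length vs - 1"
  have n: "length vs = Suc n" "2 \<le> n" using l by (auto simp: n_def)
  have ab: "vs ! 0 \<noteq> vs ! n" using d n by (simp add: nth_eq_iff_index_eq)
  have last: "{vs ! 0, vs ! n} \<in> E" using e[of n] n by (simp add: insert_commute)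
  have "conn (E - {{vs ! 0, vs ! n}}) (vs ! 0) (vs ! k)" if "k \<le> n" for k
    using that
  proof (induction k)
    case (Suc k)
    have "{vs ! k, vs ! Suc k} \<in> E" using e[of k] Suc.prems n by simp
    moreover have "{vs ! k, vs ! Suc k} \<noteq> {vs ! 0, vs ! n}"
      using d n Suc.prems by (auto simp: doubleton_eq_iff nth_eq_iff_index_eq)
    ultimately have "conn (E - {{vs ! 0, vs ! n}}) (vs ! k) (vs ! Suc k)"
      by (intro conn_edge) blast
    with Suc show ?case by (meson Suc_leD conn_trans)
  qed simp
  with ab last show "\<exists>a b. a \<noteq> b \<and> {a, b} \<in> E \<and> conn (E - {{a, b}}) a b" by blast
next
  assume "\<exists>a b. a \<noteq> b \<and> {a, b} \<in> E \<and> conn (E - {{a, b}}) a b"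
  then obtain a b where ab: "a \<noteq> b" "{a, b} \<in> E" and c: "conn (E - {{a, b}}) a b" by blast
  let ?r = "\<lambda>x y. {x, y} \<in> E - {{a, b}}"
  from c obtain ys where "rtrancl_path ?r a ys b"
    unfolding conn_def rtranclp_eq_rtrancl_path by blast
  then obtain xs where p: "rtrancl_path ?r a xs b" and d: "distinct (a # xs)"
    by (rule rtrancl_path_distinct)
  have ne: "xs \<noteq> []" using p ab(1) by (auto elim: rtrancl_path.cases)
  have last: "last xs = b" using p ne by (rule rtrancl_path_last)
  have nth: "?r ((a # xs) ! i) (xs ! i)" if "i < length xs" for i
    using p that by (rule rtrancl_path_nth)
  \<comment> \<open>A path of a single edge would be \<open>ab\<close> itself, which has been
    removed; so there are at least three vertices.\<close>
  have "length xs \<noteq> 1"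
    using nth[of 0] last by (auto simp: length_Suc_conv)
  then have "3 \<le> length (a # xs)" using ne by (cases xs) (auto simp: Suc_le_eq)
  moreover have "{(a # xs) ! k, (a # xs) ! (Suc k mod length (a # xs))} \<in> E"
    if "k < length (a # xs)" for k
  proof (cases "k = length xs")
    case True
    then have "(a # xs) ! k = b" using ne last by (simp add: last_conv_nth nth_Cons')
    then show ?thesis using True ab(2) by (simp add: insert_commute)
  next
    case False
    then show ?thesis using nth[of k] that by simp
  qed
  ultimately have "is_cycle E (a # xs)" using d unfolding is_cycle_def by blast
  then show "has_cycle E" unfolding has_cycle_def by blast
qed

lemma has_cycle_mono: "has_cycle E \<Longrightarrow> E \<subseteq> F \<Longrightarrow> has_cycle F"
  unfolding has_cycle_def is_cycle_def by blast

lemma complete_edges_eq: "complete_edges n = {e. e \<subseteq> {1..n} \<and> card e = 2}"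
proof (intro set_eqI iffI)
  fix e assume "e \<in> {e. e \<subseteq> {1..n} \<and> card e = 2}"
  then obtain i j where "e = {i, j}" "i \<noteq> j" "{i, j} \<subseteq> {1..n}"
    by (auto simp: card_2_iff)
  then show "e \<in> complete_edges n" unfolding complete_edges_def by blast
qed (auto simp: complete_edges_def)

lemma finite_complete_edges [simp]: "finite (complete_edges n)"
  unfolding complete_edges_eq by (rule finite_subset[of _ "Pow {1..n}"]) auto

lemma card_complete_edges: "card (complete_edges n) = n choose 2"
  unfolding complete_edges_eq using n_subsets[of "{1..n}" 2] by simp

section \<open>Counting connected components\<close>

definition component :: "nat \<Rightarrow> nat set set \<Rightarrow> nat \<Rightarrow> nat set" where
  "component n E x = {y \<in> {1..n}. conn E x y}"

definition components :: "nat \<Rightarrow> nat set set \<Rightarrow> nat set set" where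
  "components n E = component n E ` {1..n}"

definition spanning :: "nat \<Rightarrow> nat set set \<Rightarrow> bool" where
  "spanning n E \<longleftrightarrow> (\<forall>x\<in>{1..n}. \<forall>y\<in>{1..n}. conn E x y)"

lemma component_eq_iff:
  assumes "x \<in> {1..n}" "y \<in> {1..n}"
  shows "component n E x = component n E y \<longleftrightarrow> conn E x y"
  using assms unfolding component_def
  by (auto dest: conn_sym intro: conn_trans)

lemma components_insert_redundant:
  assumes "conn E a b"
  shows "components n (insert {a, b} E) = components n E"
proof -
  have "conn (insert {a, b} E) x y \<longleftrightarrow> conn E x y" for x y
    unfolding conn_insert using assms by (meson conn_trans conn_sym)
  then show ?thesis unfolding components_def component_def by simp
qed

text \<open>The classes of \<open>a\<close> and \<open>b\<close> merge into one and every other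
  class stays, so exactly one class is lost.\<close>

lemma card_components_insert:
  assumes ab: "a \<in> {1..n}" "b \<in> {1..n}" and nc: "\<not> conn E a b"
  shows "card (components n E) = Suc (card (components n (insert {a, b} E)))"
proof -
  let ?c = "component n E"
  let ?ab = "{?c a, ?c b}"
  have new: "component n (insert {a, b} E) x =
      (if conn E x a \<or> conn E x b then ?c a \<union> ?c b else ?c x)" for x
    unfolding component_def conn_insert using nc
    by (auto dest: conn_sym intro: conn_trans)
  have "components n (insert {a, b} E) = insert (?c a \<union> ?c b) (components n E - ?ab)"
  proof (intro equalityI subsetI)
    fix C assume "C \<in> components n (insert {a, b} E)"
    then obtain x where x: "x \<in> {1..n}" "C = component n (insert {a, b} E) x"
      unfolding components_def by blast
    then show "C \<in> insert (?c a \<union> ?c b) (components n E - ?ab)"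
      using ab component_eq_iff[of x n a E] component_eq_iff[of x n b E]
      by (auto simp: new components_def)
  next
    fix C assume "C \<in> insert (?c a \<union> ?c b) (components n E - ?ab)"
    then consider "C = ?c a \<union> ?c b" | x where "x \<in> {1..n}" "C = ?c x" "?c x \<notin> ?ab"
      unfolding components_def by blast
    then show "C \<in> components n (insert {a, b} E)"
    proof cases
      case 1
      then have "C = component n (insert {a, b} E) a" by (simp add: new)
      then show ?thesis using ab unfolding components_def by blast
    next
      case 2
      then have "C = component n (insert {a, b} E) x"
        using ab component_eq_iff[of x n a E] component_eq_iff[of x n b E] by (simp add: new)
      then show ?thesis using 2 unfolding components_def by blast
    qed
  qed
  \<comment> \<open>The merged class is not an old one: an old class containing \<open>a\<close> is
    the class of \<open>a\<close>, which has been taken out. So two classes go and one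
    comes.\<close>
  moreover have "?c a \<union> ?c b \<notin> components n E - ?ab"
  proof
    assume "?c a \<union> ?c b \<in> components n E - ?ab"
    then obtain x where x: "x \<in> {1..n}" "?c a \<union> ?c b = ?c x" "?c x \<noteq> ?c a"
      unfolding components_def by blast
    have "a \<in> ?c a" using ab by (simp add: component_def)
    with x(2) have "a \<in> ?c x" by blast
    then have "conn E x a" by (simp add: component_def)
    with x ab show False by (simp add: component_eq_iff)
  qed
  moreover have "?ab \<subseteq> components n E" "card ?ab = 2"
    using ab nc by (auto simp: components_def component_eq_iff)
  moreover have "finite (components n E)" by (simp add: components_def)
  moreover have "card (components n E) \<ge> 2"
    using calculation by (metis card_mono)
  ultimately show ?thesis by (simp add: card_Diff_subset)
qed

lemma card_components_empty: "card (components n {}) = n"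
proof -
  have "conn {} x y \<longleftrightarrow> x = y" for x y :: nat
    by (auto simp: conn_def elim: rtranclp.cases)
  then have "inj_on (component n {}) {1..n}"
    by (auto simp: inj_on_def component_eq_iff)
  then show ?thesis by (simp add: components_def card_image)
qed

lemma complete_edgesE:
  assumes "e \<in> complete_edges n"
  obtains a b where "e = {a, b}" "a \<in> {1..n}" "b \<in> {1..n}" "a \<noteq> b"
  using assms unfolding complete_edges_def by blast

lemma complete_edges_doubleton:
  "{a, b} \<in> complete_edges n \<longleftrightarrow> a \<in> {1..n} \<and> b \<in> {1..n} \<and> a \<noteq> b"
  unfolding complete_edges_def by (auto simp: doubleton_eq_iff)

text \<open>Starting from \<open>n\<close> singletons, each edge lowers the number of components by
  at most one.\<close>

lemma card_plus_components_ge: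
  assumes "E \<subseteq> complete_edges n"
  shows "n \<le> card E + card (components n E)"
proof -
  have "finite E" using assms finite_complete_edges by (rule finite_subset)
  then show ?thesis using assms
  proof (induction E rule: finite_induct)
    case empty
    then show ?case by (simp add: card_components_empty)
  next
    case (insert e E)
    then obtain a b where e: "e = {a, b}" "a \<in> {1..n}" "b \<in> {1..n}"
      by (auto elim: complete_edgesE)
    then show ?case
      using insert card_components_insert[of a n b E]
        components_insert_redundant[of E a b n]
      by (cases "conn E a b") auto
  qed
qed

text \<open>Equality in the preceding bound singles out forests: there every edge joins two
  components, while removing an edge of a cycle would keep the components and violate the
  bound.\<close>

lemma has_cycle_iff_card_components:
  assumes "E \<subseteq> complete_edges n"
  shows "\<not> has_cycle E \<longleftrightarrow> card E + card (components n E) = n"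
proof
  have fin: "finite E" using assms finite_complete_edges by (rule finite_subset)
  {
    assume "\<not> has_cycle E"
    with fin assms show "card E + card (components n E) = n"
    proof (induction E rule: finite_induct)
      case empty
      then show ?case by (simp add: card_components_empty)
    next
      case (insert e E)
      then obtain a b where e: "e = {a, b}" "a \<in> {1..n}" "b \<in> {1..n}" "a \<noteq> b"
        by (auto elim: complete_edgesE)
      have "\<not> conn E a b"
      proof
        assume "conn E a b"
        moreover have "insert e E - {{a, b}} = E" using insert.hyps e by auto
        ultimately have "has_cycle (insert e E)"
          unfolding has_cycle_iff using e by (metis insertI1)
        with insert.prems show False by blast
      qed
      then have "card (components n E) = Suc (card (components n (insert e E)))"
        unfolding e(1) by (rule card_components_insert[OF e(2,3)])
      moreover have "card E + card (components n E) = n"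
        using insert has_cycle_mono[of E "insert e E"] by blast
      ultimately show ?case using insert.hyps by simp
    qed
  next
    assume eq: "card E + card (components n E) = n"
    show "\<not> has_cycle E"
    proof
      assume "has_cycle E"
      then obtain a b where ab: "{a, b} \<in> E" "conn (E - {{a, b}}) a b"
        unfolding has_cycle_iff by blast
      have "insert {a, b} (E - {{a, b}}) = E" using ab by blast
      then have "components n E = components n (E - {{a, b}})"
        using components_insert_redundant[OF ab(2)] by simp
      moreover have "card E = Suc (card (E - {{a, b}}))"
        using ab(1) fin by (metis card_Suc_Diff1)
      moreover have "n \<le> card (E - {{a, b}}) + card (components n (E - {{a, b}}))"
        using assms by (intro card_plus_components_ge) auto
      ultimately show False using eq by simp
    qed
  }
qed

lemma spanning_iff_card_components:
  assumes "0 < n"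
  shows "spanning n E \<longleftrightarrow> card (components n E) = 1"
proof
  assume "spanning n E"
  then have "component n E x = component n E 1" if "x \<in> {1..n}" for x
    using that assms unfolding spanning_def by (subst component_eq_iff) auto
  moreover have "{1..n} \<noteq> {}" using assms by simp
  ultimately have "components n E = {component n E 1}"
    unfolding components_def by blast
  then show "card (components n E) = 1" by simp
next
  assume "card (components n E) = 1"
  then obtain C where "component n E ` {1..n} = {C}"
    unfolding components_def by (auto simp: card_1_singleton_iff)
  then have "component n E x = component n E y" if "x \<in> {1..n}" "y \<in> {1..n}" for x y
    using that by blast
  then show "spanning n E" by (auto simp: spanning_def component_eq_iff)
qed

lemma card_components_pos: "0 < n \<Longrightarrow> 0 < card (components n E)"
  by (simp add: components_def card_gt_0_iff)

lemma forest_card_less: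
  assumes "E \<subseteq> complete_edges n" "0 < n" "\<not> has_cycle E"
  shows "card E < n"
  using assms card_components_pos[of n E] has_cycle_iff_card_components[of E n] by simp

lemma forest_iff_spanning:
  assumes "E \<subseteq> complete_edges n" "Suc (card E) = n"
  shows "\<not> has_cycle E \<longleftrightarrow> spanning n E"
  using assms by (simp add: has_cycle_iff_card_components spanning_iff_card_components) linarith

section \<open>Uniqueness of the involutions\<close>

lemma partitions_subset: "P \<in> partitions d n \<Longrightarrow> i \<in> {1..d} \<Longrightarrow> P i \<subseteq> complete_edges n"
  unfolding partitions_def by blast

lemma partitions_disjoint:
  "P \<in> partitions d n \<Longrightarrow> i \<in> {1..d} \<Longrightarrow> j \<in> {1..d} \<Longrightarrow> e \<in> P i \<Longrightarrow> e \<in> P j \<Longrightarrow> i = j"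
  unfolding partitions_def disjoint_family_on_def by blast

lemma partitions_cover:
  assumes "P \<in> partitions d n" "e \<in> complete_edges n"
  obtains i where "i \<in> {1..d}" "e \<in> P i"
proof -
  from assms have "e \<in> (\<Union>i\<in>{1..d}. P i)" by (simp add: partitions_def)
  with that show thesis by blast
qed

lemma partitions_eqI:
  assumes "P \<in> partitions d n" "Q \<in> partitions d n"
    and "\<And>e. e \<in> complete_edges n \<Longrightarrow> coincide_on d P Q e"
  shows "P = Q"
proof (rule PiE_ext)
  show "P \<in> {1..d} \<rightarrow>\<^sub>E Pow (complete_edges n)" "Q \<in> {1..d} \<rightarrow>\<^sub>E Pow (complete_edges n)"
    using assms(1,2) by (simp_all add: partitions_def)
  fix i assume i: "i \<in> {1..d}"
  have "e \<in> P i \<longleftrightarrow> e \<in> Q i" if "e \<in> complete_edges n" for e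
    using assms(3)[OF that] i by (simp add: coincide_on_def)
  with partitions_subset[OF assms(1) i] partitions_subset[OF assms(2) i]
  show "P i = Q i" by blast
qed

text \<open>The \<open>d\<close> forests have at most \<open>2 * d - 1\<close> edges each and must
  share \<open>d * (2 * d - 1)\<close> edges, so none can fall short of its bound.\<close>

lemma card_part:
  assumes P: "P \<in> cf_partitions d (2 * d)" and i: "i \<in> {1..d}"
  shows "card (P i) = 2 * d - 1"
proof -
  have part: "P \<in> partitions d (2 * d)"
    using P by (simp add: cf_partitions_def)
  have "(\<Sum>i\<in>{1..d}. card (P i)) = card (\<Union>i\<in>{1..d}. P i)"
  proof (rule card_UN_disjoint[symmetric])
    show "\<forall>i\<in>{1..d}. finite (P i)"
      using partitions_subset[OF part] finite_complete_edges finite_subset by blast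
    show "\<forall>i\<in>{1..d}. \<forall>j\<in>{1..d}. i \<noteq> j \<longrightarrow> P i \<inter> P j = {}"
      using partitions_disjoint[OF part] by blast
  qed simp
  also have "\<dots> = (2 * d) choose 2"
    using part by (simp add: partitions_def card_complete_edges)
  also have "\<dots> = (\<Sum>i\<in>{1..d}. 2 * d - 1)"
    by (simp add: choose_two)
  finally have eq: "(\<Sum>i\<in>{1..d}. card (P i)) = (\<Sum>i\<in>{1..d}. 2 * d - 1)" .
  have "card (P j) \<le> 2 * d - 1" if "j \<in> {1..d}" for j
    using forest_card_less[of "P j" "2 * d"] partitions_subset[OF part that] P that
    by (auto simp: cf_partitions_def)
  from sum_mono_inv[OF eq this i] show ?thesis by simp
qed

text \<open>Acyclicity is replaced by size and connectivity, the two properties that are easy to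
  follow through an exchange of edges.\<close>

lemma cf_partitions_iff:
  assumes "P \<in> partitions d (2 * d)"
  shows "P \<in> cf_partitions d (2 * d) \<longleftrightarrow>
    (\<forall>i\<in>{1..d}. card (P i) = 2 * d - 1 \<and> spanning (2 * d) (P i))"
proof -
  have *: "\<not> has_cycle (P i) \<longleftrightarrow> spanning (2 * d) (P i)"
    if "i \<in> {1..d}" "card (P i) = 2 * d - 1" for i
    using that partitions_subset[OF assms] by (intro forest_iff_spanning) auto
  show ?thesis
  proof
    assume P: "P \<in> cf_partitions d (2 * d)"
    with * card_part[OF P] show "\<forall>i\<in>{1..d}. card (P i) = 2 * d - 1 \<and> spanning (2 * d) (P i)"
      by (auto simp: cf_partitions_def)
  next
    assume "\<forall>i\<in>{1..d}. card (P i) = 2 * d - 1 \<and> spanning (2 * d) (P i)"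
    with * assms show "P \<in> cf_partitions d (2 * d)"
      by (auto simp: cf_partitions_def)
  qed
qed

lemma spanning_part:
  "P \<in> cf_partitions d (2 * d) \<Longrightarrow> i \<in> {1..d} \<Longrightarrow> spanning (2 * d) (P i)"
  using cf_partitions_iff[of P d] by (auto simp: cf_partitions_def)

text \<open>Exactly two vertices of a triangle lie in one component of a spanning tree
  with one edge removed, so one edge of the triangle cannot complete it again.\<close>

lemma triangle_forbidden_edge:
  assumes "spanning n (insert {x, y} F)" "x \<in> {1..n}" "z \<in> {1..n}" "x \<noteq> z" "y \<noteq> z"
    and "{x, z} \<notin> F" "{y, z} \<notin> F"
    and "\<not> has_cycle (insert {x, z} F)" "\<not> has_cycle (insert {y, z} F)"
  shows False
proof -
  have "conn (insert {x, y} F) z x"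
    using assms by (simp add: spanning_def)
  then have "conn F z x \<or> conn F z y" by (auto simp: conn_insert)
  then show False
  proof
    assume "conn F z x"
    then have "conn (insert {x, z} F - {{x, z}}) x z"
      using assms(6) by (simp add: conn_commute)
    then show False using assms(4,8) unfolding has_cycle_iff by blast
  next
    assume "conn F z y"
    then have "conn (insert {y, z} F - {{y, z}}) y z"
      using assms(7) by (simp add: conn_commute)
    then show False using assms(5,9) unfolding has_cycle_iff by blast
  qed
qed

text \<open>The multiplicities of the colours among the \<open>p\<close> add up to three, so equal
  multiplicities leave no room for another colour among the \<open>q\<close>.\<close>

lemma triple_rearrangement:
  fixes p1 p2 p3 :: 'a
  assumes "\<And>i. i \<in> {p1, p2, p3} \<Longrightarrow>
    of_bool (p1 = i) + of_bool (p2 = i) + of_bool (p3 = i) =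
    (of_bool (q1 = i) + of_bool (q2 = i) + of_bool (q3 = i) :: nat)"
  shows "(q1, q2, q3) \<in>
      {(p1, p2, p3), (p1, p3, p2), (p2, p1, p3), (p2, p3, p1), (p3, p1, p2), (p3, p2, p1)}"
proof -
  have 1: "1 + of_bool (p2 = p1) + of_bool (p3 = p1) =
    (of_bool (q1 = p1) + of_bool (q2 = p1) + of_bool (q3 = p1) :: nat)"
    using assms[of p1] by simp
  have 2: "of_bool (p1 = p2) + 1 + of_bool (p3 = p2) =
    (of_bool (q1 = p2) + of_bool (q2 = p2) + of_bool (q3 = p2) :: nat)"
    using assms[of p2] by simp
  have 3: "of_bool (p1 = p3) + of_bool (p2 = p3) + 1 =
    (of_bool (q1 = p3) + of_bool (q2 = p3) + of_bool (q3 = p3) :: nat)"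
    using assms[of p3] by simp
  show ?thesis using 1 2 3 
    by (cases "p1 = p2"; cases "p1 = p3"; cases "p2 = p3"; cases "q1 = p1"; cases "q2 = p1"; cases
        "q3 = p1"; cases "q1 = p2"; cases "q2 = p2"; cases "q3 = p2"; simp split: split_of_bool_asm)
qed

text \<open>All parts have the same size, so \<open>Q\<close> and \<open>R\<close> merely permute
  the colours that \<open>P\<close> gives to the three edges of the triangle. A colour used once
  cannot occupy three different edges in \<open>P\<close>, \<open>Q\<close> and \<open>R\<close>, by
  \<open>triangle_forbidden_edge\<close>; this leaves at most one arrangement different from that of
  \<open>P\<close>.\<close>

lemma involution_unique:
  assumes P: "P \<in> cf_partitions d (2 * d)" and Q: "Q \<in> cf_partitions d (2 * d)"
    and R: "R \<in> cf_partitions d (2 * d)"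
    and x: "x \<in> {1..2 * d}" and y: "y \<in> {1..2 * d}" and z: "z \<in> {1..2 * d}"
    and neq: "x \<noteq> y" "x \<noteq> z" "y \<noteq> z"
    and PQ: "\<And>e. e \<in> complete_edges (2 * d) - {{x, y}, {x, z}, {y, z}} \<Longrightarrow> coincide_on d P Q e"
    and PR: "\<And>e. e \<in> complete_edges (2 * d) - {{x, y}, {x, z}, {y, z}} \<Longrightarrow> coincide_on d P R e"
    and "P \<noteq> Q" "P \<noteq> R"
  shows "Q = R"
proof -
  let ?T = "{{x, y}, {x, z}, {y, z}}"
  have part: "P \<in> partitions d (2 * d)" "Q \<in> partitions d (2 * d)" "R \<in> partitions d (2 * d)"
    using P Q R by (simp_all add: cf_partitions_def)
  have T: "?T \<subseteq> complete_edges (2 * d)"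
    using x y z neq by (simp add: complete_edges_doubleton)
  have dist: "{x, y} \<noteq> {x, z}" "{x, y} \<noteq> {y, z}" "{x, z} \<noteq> {y, z}"
    using neq by (auto simp: doubleton_eq_iff)
  have colour: "\<exists>k\<in>{1..d}. \<forall>i\<in>{1..d}. e \<in> S i \<longleftrightarrow> k = i"
    if S: "S \<in> partitions d (2 * d)" and e: "e \<in> ?T" for S e
  proof -
    have "e \<in> complete_edges (2 * d)" using e T by blast
    then obtain k where k: "k \<in> {1..d}" "e \<in> S k"
      using partitions_cover[OF S] by metis
    then have "e \<in> S i \<longleftrightarrow> k = i" if "i \<in> {1..d}" for i
      using partitions_disjoint[OF S that k(1)] by blast
    with k(1) show ?thesis by blast
  qed
  obtain p1 p2 p3 where p: "p1 \<in> {1..d}" "p2 \<in> {1..d}" "p3 \<in> {1..d}"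
      "\<And>i. i \<in> {1..d} \<Longrightarrow> {x, y} \<in> P i \<longleftrightarrow> p1 = i"
      "\<And>i. i \<in> {1..d} \<Longrightarrow> {x, z} \<in> P i \<longleftrightarrow> p2 = i"
      "\<And>i. i \<in> {1..d} \<Longrightarrow> {y, z} \<in> P i \<longleftrightarrow> p3 = i"
    using colour[OF part(1), of "{x, y}"] colour[OF part(1), of "{x, z}"]
      colour[OF part(1), of "{y, z}"] by auto
  obtain q1 q2 q3 where q:
      "\<And>i. i \<in> {1..d} \<Longrightarrow> {x, y} \<in> Q i \<longleftrightarrow> q1 = i"
      "\<And>i. i \<in> {1..d} \<Longrightarrow> {x, z} \<in> Q i \<longleftrightarrow> q2 = i"
      "\<And>i. i \<in> {1..d} \<Longrightarrow> {y, z} \<in> Q i \<longleftrightarrow> q3 = i"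
    using colour[OF part(2), of "{x, y}"] colour[OF part(2), of "{x, z}"]
      colour[OF part(2), of "{y, z}"] by auto
  obtain r1 r2 r3 where r:
      "\<And>i. i \<in> {1..d} \<Longrightarrow> {x, y} \<in> R i \<longleftrightarrow> r1 = i"
      "\<And>i. i \<in> {1..d} \<Longrightarrow> {x, z} \<in> R i \<longleftrightarrow> r2 = i"
      "\<And>i. i \<in> {1..d} \<Longrightarrow> {y, z} \<in> R i \<longleftrightarrow> r3 = i"
    using colour[OF part(3), of "{x, y}"] colour[OF part(3), of "{x, z}"]
      colour[OF part(3), of "{y, z}"] by auto
  define F where "F i = P i - ?T" for i
  have FQ: "Q i - ?T = F i" if "i \<in> {1..d}" for i
  proof -
    have "e \<in> P i \<longleftrightarrow> e \<in> Q i" if "e \<in> complete_edges (2 * d) - ?T" for e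
      using PQ[OF that] \<open>i \<in> {1..d}\<close> by (simp add: coincide_on_def)
    with partitions_subset[OF part(1) that] partitions_subset[OF part(2) that]
    show ?thesis unfolding F_def by blast
  qed
  have FR: "R i - ?T = F i" if "i \<in> {1..d}" for i
  proof -
    have "e \<in> P i \<longleftrightarrow> e \<in> R i" if "e \<in> complete_edges (2 * d) - ?T" for e
      using PR[OF that] \<open>i \<in> {1..d}\<close> by (simp add: coincide_on_def)
    with partitions_subset[OF part(1) that] partitions_subset[OF part(3) that]
    show ?thesis unfolding F_def by blast
  qed
  \<comment> \<open>Since the size of a part is fixed, \<open>F i\<close> determines how many
    triangle edges have colour \<open>i\<close>.\<close>
  have count: "card (F i) + (of_bool ({x, y} \<in> S i) + of_bool ({x, z} \<in> S i) + of_bool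
      ({y, z} \<in> S i)) = 2 * d - 1"
    if "S \<in> cf_partitions d (2 * d)" "i \<in> {1..d}" "S i - ?T = F i" for S i
  proof -
    have "S \<in> partitions d (2 * d)" using that(1) by (simp add: cf_partitions_def)
    from partitions_subset[OF this that(2)] have "finite (S i)"
      using finite_complete_edges by (rule finite_subset)
    then have "card (S i) = card (S i \<inter> ?T) + card (S i - ?T)"
      by (rule card_Int_Diff)
    also have "S i \<inter> ?T = (if {x, y} \<in> S i then {{x, y}} else {}) \<union>
        (if {x, z} \<in> S i then {{x, z}} else {}) \<union> (if {y, z} \<in> S i then {{y, z}} else {})"
      by (auto simp only: split: if_splits)
    also have "card \<dots> = of_bool ({x, y} \<in> S i) + of_bool ({x, z} \<in> S i) + of_bool ({y, z} \<in> S i)"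
      using dist by simp
    finally show ?thesis unfolding card_part[OF that(1,2)] that(3) by simp
  qed
  have perm_q: "(q1, q2, q3) \<in>
      {(p1, p2, p3), (p1, p3, p2), (p2, p1, p3), (p2, p3, p1), (p3, p1, p2), (p3, p2, p1)}"
  proof (rule triple_rearrangement)
    fix i assume "i \<in> {p1, p2, p3}"
    then have i: "i \<in> {1..d}" using p by blast
    from count[OF P i] count[OF Q i FQ[OF i]]
    show "of_bool (p1 = i) + of_bool (p2 = i) + of_bool (p3 = i) =
      (of_bool (q1 = i) + of_bool (q2 = i) + of_bool (q3 = i) :: nat)"
      by (simp add: p(4-6)[OF i] q[OF i] F_def)
  qed
  have perm_r: "(r1, r2, r3) \<in>
      {(p1, p2, p3), (p1, p3, p2), (p2, p1, p3), (p2, p3, p1), (p3, p1, p2), (p3, p2, p1)}"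
  proof (rule triple_rearrangement)
    fix i assume "i \<in> {p1, p2, p3}"
    then have i: "i \<in> {1..d}" using p by blast
    from count[OF P i] count[OF R i FR[OF i]]
    show "of_bool (p1 = i) + of_bool (p2 = i) + of_bool (p3 = i) =
      (of_bool (r1 = i) + of_bool (r2 = i) + of_bool (r3 = i) :: nat)"
      by (simp add: p(4-6)[OF i] r[OF i] F_def)
  qed
  \<comment> \<open>Otherwise \<open>F i\<close> would become a tree with each of the three triangle
    edges in turn.\<close>
  have forb: False
    if i: "i \<in> {1..d}" and S: "S1 \<in> {P, Q, R}" "S2 \<in> {P, Q, R}" "S3 \<in> {P, Q, R}"
      and s1: "{x, y} \<in> S1 i" "{x, z} \<notin> S1 i" "{y, z} \<notin> S1 i"
      and s2: "{x, y} \<notin> S2 i" "{x, z} \<in> S2 i" "{y, z} \<notin> S2 i"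
      and s3: "{x, y} \<notin> S3 i" "{x, z} \<notin> S3 i" "{y, z} \<in> S3 i" for i S1 S2 S3
  proof -
    have F: "S i - ?T = F i" and cf: "S \<in> cf_partitions d (2 * d)" if "S \<in> {P, Q, R}" for S
      using that FQ[OF i] FR[OF i] P Q R unfolding F_def by (elim insertE emptyE; simp)+
    have "S1 i = insert {x, y} (S1 i - ?T)" using s1 by blast
    moreover have "S2 i = insert {x, z} (S2 i - ?T)" using s2 by blast
    moreover have "S3 i = insert {y, z} (S3 i - ?T)" using s3 by blast
    ultimately have eqs: "S1 i = insert {x, y} (F i)" "S2 i = insert {x, z} (F i)"
        "S3 i = insert {y, z} (F i)"
      unfolding F[OF S(1)] F[OF S(2)] F[OF S(3)] .
    have "spanning (2 * d) (S1 i)"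
      using cf[OF S(1)] i by (rule spanning_part)
    moreover have "\<not> has_cycle (S2 i)" "\<not> has_cycle (S3 i)"
      using cf[OF S(2)] cf[OF S(3)] i by (auto simp: cf_partitions_def)
    moreover have "{x, z} \<notin> F i" "{y, z} \<notin> F i" by (simp_all add: F_def)
    ultimately show False
      using triangle_forbidden_edge[of "2 * d" x y "F i" z] x z neq by (simp add: eqs)
  qed
  have nPQ: "(p1, p2, p3) \<noteq> (q1, q2, q3)"
  proof
    assume "(p1, p2, p3) = (q1, q2, q3)"
    then have "coincide_on d P Q e" if "e \<in> complete_edges (2 * d)" for e
      using that PQ p q by (cases "e \<in> ?T") (auto simp: coincide_on_def)
    with part have "P = Q" by (blast intro: partitions_eqI)
    with \<open>P \<noteq> Q\<close> show False ..
  qed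
  have nPR: "(p1, p2, p3) \<noteq> (r1, r2, r3)"
  proof
    assume "(p1, p2, p3) = (r1, r2, r3)"
    then have "coincide_on d P R e" if "e \<in> complete_edges (2 * d)" for e
      using that PR p r by (cases "e \<in> ?T") (auto simp: coincide_on_def)
    with part have "P = R" by (blast intro: partitions_eqI)
    with \<open>P \<noteq> R\<close> show False ..
  qed
  \<comment> \<open>A colour on exactly one triangle edge must not be sent by \<open>Q\<close> to
    one of the two other edges and by \<open>R\<close> to the other. Together with the rearrangement
    property this settles all patterns of equal and distinct colours.\<close>
  have "\<not> (q2 = p1 \<and> r3 = p1)" "\<not> (q3 = p1 \<and> r2 = p1)" if "p1 \<noteq> p2" "p1 \<noteq> p3"
    using forb[OF p(1), of P Q R] forb[OF p(1), of P R Q] perm_q perm_r that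
    by (auto simp: p(4-6)[OF p(1)] q[OF p(1)] r[OF p(1)])
  moreover have "\<not> (q1 = p2 \<and> r3 = p2)" "\<not> (q3 = p2 \<and> r1 = p2)" if "p2 \<noteq> p1" "p2 \<noteq> p3"
    using forb[OF p(2), of Q P R] forb[OF p(2), of R P Q] perm_q perm_r that
    by (auto simp: p(4-6)[OF p(2)] q[OF p(2)] r[OF p(2)])
  moreover have "\<not> (q1 = p3 \<and> r2 = p3)" "\<not> (q2 = p3 \<and> r1 = p3)" if "p3 \<noteq> p1" "p3 \<noteq> p2"
    using forb[OF p(3), of Q R P] forb[OF p(3), of R Q P] perm_q perm_r that
    by (auto simp: p(4-6)[OF p(3)] q[OF p(3)] r[OF p(3)])
  ultimately have "(q1, q2, q3) = (r1, r2, r3)"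
    using perm_q perm_r nPQ nPR by auto
  then have "coincide_on d Q R e" if "e \<in> complete_edges (2 * d)" for e
    using that PQ PR q r by (cases "e \<in> ?T") (auto simp: coincide_on_def)
  with part show ?thesis by (blast intro: partitions_eqI)
qed

section \<open>Exchanging adjacent edges\<close>

definition exchange ::
    "(nat \<Rightarrow> nat set set) \<Rightarrow> nat \<Rightarrow> nat \<Rightarrow> nat set \<Rightarrow> nat set \<Rightarrow> (nat \<Rightarrow> nat set set)" where
  "exchange P i j e f = P(i := insert f (P i - {e}), j := insert e (P j - {f}))"

lemma spanning_exchange:
  assumes "spanning n E" "conn (insert f (E - {{x, y}})) x y"
  shows "spanning n (insert f (E - {{x, y}}))"
  unfolding spanning_def
proof (intro ballI)
  fix u w assume "u \<in> {1..n}" "w \<in> {1..n}"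
  then have "conn E u w" using assms(1) by (simp add: spanning_def)
  then show "conn (insert f (E - {{x, y}})) u w"
  proof (rule conn_subst)
    fix a b assume ab: "{a, b} \<in> E"
    show "conn (insert f (E - {{x, y}})) a b"
    proof (cases "{a, b} = {x, y}")
      case True
      then show ?thesis using assms(2) conn_sym by (auto simp: doubleton_eq_iff)
    next
      case False
      then show ?thesis using ab by (simp add: conn_edge)
    qed
  qed
qed

lemma card_swap:
  assumes "finite E" "a \<in> E" "b \<notin> E"
  shows "card (insert b (E - {a})) = card E"
  using assms by (metis DiffD1 card_Suc_Diff1 card_insert_disjoint finite_Diff)

text \<open>Trees \<open>i\<close> and \<open>j\<close> trade the edges \<open>xy\<close> and
  \<open>xz\<close>. The common vertex places both edges in the triangle \<open>xyz\<close>, so an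
  involution can perform the trade; \<open>conn_i\<close> and \<open>conn_j\<close> say that both
  trees stay connected.\<close>

locale exchangeable =
  fixes d :: nat and P :: "nat \<Rightarrow> nat set set" and i j x y z :: nat
  assumes P: "P \<in> cf_partitions d (2 * d)"
    and i: "i \<in> {1..d}" and j: "j \<in> {1..d}" and ij: "i \<noteq> j"
    and yz: "y \<noteq> z"
    and xy: "{x, y} \<in> P i" and xz: "{x, z} \<in> P j"
    and conn_i: "conn (insert {x, z} (P i - {{x, y}})) x y"
    and conn_j: "conn (insert {x, y} (P j - {{x, z}})) x z"
begin

abbreviation Q where "Q \<equiv> exchange P i j {x, y} {x, z}"

lemma part: "P \<in> partitions d (2 * d)"
  using P by (simp add: cf_partitions_def)

lemma edges: "{x, y} \<in> complete_edges (2 * d)" "{x, z} \<in> complete_edges (2 * d)"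
  using partitions_subset[OF part i] partitions_subset[OF part j] xy xz by auto

lemma vertices: "x \<in> {1..2 * d}" "y \<in> {1..2 * d}" "z \<in> {1..2 * d}" "x \<noteq> y" "x \<noteq> z"
  using edges by (auto simp: complete_edges_doubleton)

lemma edges_neq: "{x, y} \<noteq> {x, z}"
  using yz by (auto simp: doubleton_eq_iff)

lemma not_in: "{x, z} \<notin> P i" "{x, y} \<notin> P j"
  using partitions_disjoint[OF part i j] xy xz ij by blast+

lemma exchange_simps: "Q i = insert {x, z} (P i - {{x, y}})" "Q j = insert {x, y} (P j - {{x, z}})"
  "k \<noteq> i \<Longrightarrow> k \<noteq> j \<Longrightarrow> Q k = P k"
  using ij by (simp_all add: exchange_def)

text \<open>Records which index each edge has after the trade; the partition axioms and the
  coincidence with \<open>P\<close> are read off from this formula.\<close>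

lemma mem_exchange:
  assumes "k \<in> {1..d}"
  shows "e \<in> Q k \<longleftrightarrow> (if e = {x, y} then k = j else if e = {x, z} then k = i else e \<in> P k)"
proof -
  have *: "{x, y} \<in> P k \<longleftrightarrow> k = i" "{x, z} \<in> P k \<longleftrightarrow> k = j"
    using partitions_disjoint[OF part assms] xy xz i j by blast+
  show ?thesis
    using * edges_neq ij by (cases "k = i"; cases "k = j") (simp_all add: exchange_simps)
qed

lemma exchange_partition: "Q \<in> partitions d (2 * d)"
proof -
  have ext: "Q k = undefined" if "k \<notin> {1..d}" for k
  proof -
    have "P k = undefined"
      using part that unfolding partitions_def by (simp add: PiE_iff extensional_def)
    moreover have "k \<noteq> i" "k \<noteq> j" using that i j by blast+
    ultimately show ?thesis by (simp add: exchange_simps)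
  qed
  have sub: "Q k \<subseteq> complete_edges (2 * d)" if "k \<in> {1..d}" for k
  proof
    fix e assume "e \<in> Q k"
    then have "e = {x, y} \<or> e = {x, z} \<or> e \<in> P k"
      unfolding mem_exchange[OF that] by presburger
    then show "e \<in> complete_edges (2 * d)"
      using partitions_subset[OF part that] edges by blast
  qed
  have "disjoint_family_on Q {1..d}"
    unfolding disjoint_family_on_def
  proof (intro ballI impI equals0I)
    fix k l e assume kl: "k \<in> {1..d}" "l \<in> {1..d}" "k \<noteq> l" and "e \<in> Q k \<inter> Q l"
    then have "e \<in> Q k" "e \<in> Q l" by blast+
    then show False
      unfolding mem_exchange[OF kl(1)] mem_exchange[OF kl(2)]
      using partitions_disjoint[OF part kl(1,2), of e] kl(3) by presburger
  qed
  moreover have "e \<in> (\<Union>k\<in>{1..d}. Q k)" if e: "e \<in> complete_edges (2 * d)" for e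
  proof -
    obtain k where k: "k \<in> {1..d}" "e \<in> P k" using partitions_cover[OF part e] .
    have "e \<in> Q i \<or> e \<in> Q j \<or> e \<in> Q k"
      unfolding mem_exchange[OF i] mem_exchange[OF j] mem_exchange[OF k(1)]
      using k(2) by presburger
    then show ?thesis using i j k(1) by blast
  qed
  moreover have "(\<Union>k\<in>{1..d}. Q k) \<subseteq> complete_edges (2 * d)" using sub by blast
  moreover have "Q \<in> {1..d} \<rightarrow>\<^sub>E Pow (complete_edges (2 * d))"
    using ext sub by (simp add: PiE_iff extensional_def)
  ultimately show ?thesis unfolding partitions_def by blast
qed

lemma exchange_cf: "Q \<in> cf_partitions d (2 * d)"
proof -
  have "card (Q k) = 2 * d - 1 \<and> spanning (2 * d) (Q k)" if k: "k \<in> {1..d}" for k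
  proof -
    have fin: "finite (P k)" using partitions_subset[OF part k] finite_complete_edges
      by (rule finite_subset)
    consider "k = i" | "k = j" | "k \<noteq> i" "k \<noteq> j" by blast
    then show ?thesis
    proof cases
      case 1
      have "card (Q k) = card (P k)"
        unfolding 1 exchange_simps(1) using fin 1 xy not_in(1) by (intro card_swap) simp_all
      with 1 card_part[OF P i] spanning_exchange[OF spanning_part[OF P i] conn_i]
      show ?thesis by (simp add: exchange_simps)
    next
      case 2
      have "card (Q k) = card (P k)"
        unfolding 2 exchange_simps(2) using fin 2 xz not_in(2) by (intro card_swap) simp_all
      with 2 card_part[OF P j] spanning_exchange[OF spanning_part[OF P j] conn_j]
      show ?thesis by (simp add: exchange_simps)
    next
      case 3
      with card_part[OF P k] spanning_part[OF P k] show ?thesis by (simp add: exchange_simps)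
    qed
  qed
  with cf_partitions_iff[OF exchange_partition] show ?thesis by blast
qed

lemma coincide_exchange_iff:
  "coincide_on d P Q e \<longleftrightarrow> e \<noteq> {x, y} \<and> e \<noteq> {x, z}"
proof -
  have "\<not> coincide_on d P Q {x, y}" "\<not> coincide_on d P Q {x, z}"
    using i xy xz not_in edges_neq ij mem_exchange[OF i, of "{x, y}"] mem_exchange[OF i, of
        "{x, z}"]
    unfolding coincide_on_def by auto
  moreover have "coincide_on d P Q e" if "e \<noteq> {x, y}" "e \<noteq> {x, z}"
    using that by (simp add: coincide_on_def mem_exchange)
  ultimately show ?thesis by blast
qed

text \<open>\<open>P\<close> differs from the exchanged tuple on exactly two edges of the triangle,
  so it meets the defining condition, and \<open>involution_unique\<close> excludes any other tuple.
  The vertices may come in any order, as weak equivalence asks for an increasing triple.\<close>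

lemma involution_exchange:
  assumes "{{a, b}, {a, c}, {b, c}} = {{x, y}, {x, z}, {y, z}}"
    and abc: "a \<in> {1..2 * d}" "b \<in> {1..2 * d}" "c \<in> {1..2 * d}" "a \<noteq> b" "a \<noteq> c" "b \<noteq> c"
  shows "involution d Q a b c = P"
proof -
  let ?T = "{{a, b}, {a, c}, {b, c}}"
  have sym: "coincide_on d R S e \<longleftrightarrow> coincide_on d S R e" for R S e
    by (auto simp: coincide_on_def)
  have "{e \<in> ?T. \<not> coincide_on d Q P e} = {{x, y}, {x, z}}"
    unfolding sym[of Q] coincide_exchange_iff assms(1) by blast
  then have card: "card {e \<in> ?T. \<not> coincide_on d Q P e} = 2"
    using edges_neq by simp
  have off: "\<forall>e\<in>complete_edges (2 * d) - ?T. coincide_on d Q P e"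
    unfolding sym[of Q] coincide_exchange_iff assms(1) by blast
  have QP: "Q \<noteq> P"
  proof
    assume "Q = P"
    then have "coincide_on d P Q {x, y}" by (simp add: coincide_on_def)
    then show False by (simp add: coincide_exchange_iff)
  qed
  show ?thesis
    unfolding involution_def
  proof (rule the_equality)
    show "P \<in> cf_partitions d (2 * d) \<and> (\<forall>e\<in>complete_edges (2 * d) - ?T. coincide_on d Q P e) \<and>
        2 \<le> card {e \<in> ?T. \<not> coincide_on d Q P e}"
      using P off card by simp
  next
    fix R
    assume R: "R \<in> cf_partitions d (2 * d) \<and> (\<forall>e\<in>complete_edges (2 * d) - ?T. coincide_on d Q R e) \<and>
        2 \<le> card {e \<in> ?T. \<not> coincide_on d Q R e}"
    have "Q \<noteq> R"
    proof
      assume "Q = R"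
      then have empty: "{e \<in> ?T. \<not> coincide_on d Q R e} = {}" by (simp add: coincide_on_def)
      from R have "2 \<le> card {e \<in> ?T. \<not> coincide_on d Q R e}" by blast
      then show False unfolding empty by simp
    qed
    with R off QP show "R = P"
      using involution_unique[OF exchange_cf _ P abc] by blast
  qed
qed

end

text \<open>The involution acts on the later tuple and yields the earlier one, which is the
  direction used in \<open>weakly_equivalent\<close>.\<close>

definition flip :: "nat \<Rightarrow> (nat \<Rightarrow> nat set set) \<Rightarrow> (nat \<Rightarrow> nat set set) \<Rightarrow> bool" where
  "flip d P Q \<longleftrightarrow> Q \<in> cf_partitions d (2 * d) \<and>
     (\<exists>a b c. 1 \<le> a \<and> a < b \<and> b < c \<and> c \<le> 2 * d \<and> involution d Q a b c = P)"

lemma (in exchangeable) flip_exchange: "flip d P Q"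
proof -
  have *: "flip d P Q" if "{{a, b}, {a, c}, {b, c}} = {{x, y}, {x, z}, {y, z}}"
    "a < b" "b < c" "{a, b, c} = {x, y, z}" for a b c
  proof -
    have "{a, b, c} \<subseteq> {1..2 * d}" using that(4) vertices by simp
    then have abc: "a \<in> {1..2 * d}" "b \<in> {1..2 * d}" "c \<in> {1..2 * d}" by simp_all
    then have "involution d Q a b c = P"
      using that(2,3) by (intro involution_exchange that(1)) simp_all
    with exchange_cf that(2,3) abc show ?thesis
      unfolding flip_def by (intro conjI exI[of _ a] exI[of _ b] exI[of _ c]) simp_all
  qed
  consider "x < y" "y < z" | "x < z" "z < y" | "y < x" "x < z" | "y < z" "z < x"
    | "z < x" "x < y" | "z < y" "y < x"
    using vertices yz by linarith
  then show ?thesis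
  proof cases
    case 1
    then show ?thesis by (intro *[of x y z]) (simp_all add: insert_commute)
  next
    case 2
    then show ?thesis by (intro *[of x z y]) (simp_all add: insert_commute)
  next
    case 3
    then show ?thesis by (intro *[of y x z]) (simp_all add: insert_commute)
  next
    case 4
    then show ?thesis by (intro *[of y z x]) (simp_all add: insert_commute)
  next
    case 5
    then show ?thesis by (intro *[of z x y]) (simp_all add: insert_commute)
  next
    case 6
    then show ?thesis by (intro *[of z y x]) (simp_all add: insert_commute)
  qed
qed

section \<open>Building chains of weak equivalence\<close>

lemma weakly_equivalent_refl:
  "P \<in> cf_partitions d (2 * d) \<Longrightarrow> weakly_equivalent d P P"
  unfolding weakly_equivalent_def by (intro exI[of _ 0] exI[of _ "\<lambda>_. P"]) auto

lemma vertex_action_comp: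
  "vertex_action d s (vertex_action d t P) = vertex_action d (s \<circ> t) P"
  unfolding vertex_action_def by (auto simp: fun_eq_iff image_image image_comp)

lemma vertex_action_id:
  assumes "P \<in> partitions d n"
  shows "vertex_action d id P = P"
  using assms unfolding partitions_def vertex_action_def
  by (auto simp: fun_eq_iff PiE_iff extensional_def)

lemma vertex_action_inv:
  assumes "P \<in> partitions d n" "s permutes {1..n}"
  shows "vertex_action d (inv s) (vertex_action d s P) = P"
  using assms by (simp add: vertex_action_comp permutes_inv_o vertex_action_id)

definition weak_chain ::
    "nat \<Rightarrow> (nat \<Rightarrow> nat set set) \<Rightarrow> (nat \<Rightarrow> nat set set) \<Rightarrow> nat \<Rightarrow> (nat \<Rightarrow> nat \<Rightarrow> nat set set) \<Rightarrow>
     (nat \<Rightarrow> nat) \<Rightarrow> (nat \<Rightarrow> nat) \<Rightarrow> (nat \<Rightarrow> nat) \<Rightarrow> (nat \<Rightarrow> nat \<Rightarrow> nat) \<Rightarrow> (nat \<Rightarrow> nat \<Rightarrow> nat) \<Rightarrow> bool" where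
  "weak_chain d P Q n S x y z \<sigma> \<tau> \<longleftrightarrow>
     (\<forall>i\<in>{0..n}. S i \<in> cf_partitions d (2 * d)) \<and> S 0 = P \<and> S n = Q \<and>
     (\<forall>i\<in>{1..n}.
        1 \<le> x i \<and> x i < y i \<and> y i < z i \<and> z i \<le> 2 * d \<and>
        \<sigma> i permutes {1..2 * d} \<and> \<tau> i permutes {1..d} \<and>
        vertex_action d (\<sigma> i)
          (index_action d (\<tau> i) (involution d (S i) (x i) (y i) (z i))) = S (i - 1))"

lemma weakly_equivalent_iff_chain:
  "weakly_equivalent d P Q \<longleftrightarrow> (\<exists>n S x y z \<sigma> \<tau>. weak_chain d P Q n S x y z \<sigma> \<tau>)"
  unfolding weakly_equivalent_def weak_chain_def ..

text \<open>Puts one step in front of a chain. The involution takes \<open>Q\<close> to the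
  relabelled \<open>P\<close>, so relabelling by \<open>inv s\<close> afterwards returns
  \<open>P\<close>; the index permutation of this step is the identity.\<close>

lemma weakly_equivalent_flip:
  assumes P: "P \<in> cf_partitions d (2 * d)" and s: "s permutes {1..2 * d}"
    and flip: "flip d (vertex_action d s P) Q" and QR: "weakly_equivalent d Q R"
  shows "weakly_equivalent d P R"
proof -
  obtain a b c where abc: "1 \<le> a" "a < b" "b < c" "c \<le> 2 * d"
    "involution d Q a b c = vertex_action d s P"
    using flip unfolding flip_def by blast
  obtain n S x y z \<sigma> \<tau> where chain: "weak_chain d Q R n S x y z \<sigma> \<tau>"
    using QR unfolding weakly_equivalent_iff_chain by blast
  then have S: "\<forall>i\<in>{0..n}. S i \<in> cf_partitions d (2 * d)" "S 0 = Q" "S n = R"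
    and steps: "\<forall>i\<in>{1..n}. 1 \<le> x i \<and> x i < y i \<and> y i < z i \<and> z i \<le> 2 * d \<and>
           \<sigma> i permutes {1..2 * d} \<and> \<tau> i permutes {1..d} \<and>
           vertex_action d (\<sigma> i)
             (index_action d (\<tau> i) (involution d (S i) (x i) (y i) (z i))) = S (i - 1)"
    unfolding weak_chain_def by simp_all
  have part: "P \<in> partitions d (2 * d)" using P by (simp add: cf_partitions_def)
  \<comment> \<open>The identity permutation of indices acts trivially because a relabelled tuple is
    \<open>undefined\<close> off \<open>{1..d}\<close>.\<close>
  have "vertex_action d s P \<in> extensional {1..d}" by (simp add: vertex_action_def)
  then have "index_action d id (vertex_action d s P) = vertex_action d s P"
    by (auto simp: index_action_def fun_eq_iff extensional_def)
  then have first: "vertex_action d (inv s) (index_action d id (involution d Q a b c)) = P"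
    using abc(5) vertex_action_inv[OF part s] by simp
  \<comment> \<open>\<open>P\<close> becomes entry 0, the new step has number 1, and the old tuples
    and steps move up by one.\<close>
  let ?S = "case_nat P S" and ?x = "\<lambda>i. if i = 1 then a else x (i - 1)" and ?y = "\<lambda>i.
      if i = 1 then b else y (i - 1)"
    and ?z = "\<lambda>i. if i = 1 then c else z (i - 1)" and ?\<sigma> = "\<lambda>i. if i = 1 then inv s else \<sigma> (i - 1)"
    and ?\<tau> = "\<lambda>i. if i = 1 then id else \<tau> (i - 1)"
  have c1: "\<forall>i\<in>{0..Suc n}. ?S i \<in> cf_partitions d (2 * d)"
  proof
    fix i assume "i \<in> {0..Suc n}"
    then show "?S i \<in> cf_partitions d (2 * d)" using S P by (cases i) auto
  qed
  have c2: "\<forall>i\<in>{1..Suc n}. 1 \<le> ?x i \<and> ?x i < ?y i \<and> ?y i < ?z i \<and> ?z i \<le> 2 * d \<and>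
      ?\<sigma> i permutes {1..2 * d} \<and> ?\<tau> i permutes {1..d} \<and>
      vertex_action d (?\<sigma> i) (index_action d (?\<tau> i) (involution d (?S i) (?x i) (?y i) (?z i))) = ?S
          (i - 1)"
    (is "\<forall>i\<in>_. ?step i")
  proof
    fix i assume i: "i \<in> {1..Suc n}"
    show "?step i"
    proof (cases "i = 1")
      case True
      then show ?thesis using abc first S(2) permutes_inv[OF s] by (simp add: permutes_id)
    next
      case False
      then obtain k where k: "i = Suc (Suc k)" using i
        by (metis One_nat_def atLeastAtMost_iff not0_implies_Suc not_one_le_zero)
      have "Suc k \<in> {1..n}" using i k by simp
      with bspec[OF steps this] show ?thesis by (simp add: k)
    qed
  qed
  have c3: "?S 0 = P" "?S (Suc n) = R" using S by simp_all
  have "weak_chain d P R (Suc n) ?S ?x ?y ?z ?\<sigma> ?\<tau>"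
    unfolding weak_chain_def by (intro conjI c1 c2 c3)
  then show ?thesis unfolding weakly_equivalent_iff_chain by blast
qed

section \<open>Relabelling the vertices of a partition\<close>

lemma has_cycle_image:
  assumes "inj s" "has_cycle E"
  shows "has_cycle ((`) s ` E)"
proof -
  obtain vs where vs: "is_cycle E vs" using assms(2) unfolding has_cycle_def by blast
  have "{map s vs ! k, map s vs ! (Suc k mod length (map s vs))} \<in> (`) s ` E"
    if k: "k < length (map s vs)" for k
  proof -
    have "{vs ! k, vs ! (Suc k mod length vs)} \<in> E" "Suc k mod length vs < length vs"
      using vs k unfolding is_cycle_def by (auto intro!: mod_less_divisor)
    then have "s ` {vs ! k, vs ! (Suc k mod length vs)} \<in> (`) s ` E" by (intro imageI)
    with \<open>Suc k mod length vs < length vs\<close> show ?thesis using k by simp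
  qed
  then have "is_cycle ((`) s ` E) (map s vs)"
    using vs inj_on_subset[OF assms(1) subset_UNIV] unfolding is_cycle_def by (simp
        add: distinct_map)
  then show ?thesis unfolding has_cycle_def by blast
qed

lemma image_complete_edges:
  assumes "s permutes {1..n}"
  shows "(`) s ` complete_edges n = complete_edges n"
proof (intro equalityI subsetI)
  fix e assume "e \<in> (`) s ` complete_edges n"
  then obtain a b where "e = s ` {a, b}" "a \<in> {1..n}" "b \<in> {1..n}" "a \<noteq> b"
    by (auto elim!: complete_edgesE)
  then show "e \<in> complete_edges n"
    using permutes_in_image[OF assms] permutes_inj[OF assms]
    by (simp add: complete_edges_doubleton inj_eq)
next
  fix e assume "e \<in> complete_edges n"
  then obtain a b where e: "e = {a, b}" "a \<in> {1..n}" "b \<in> {1..n}" "a \<noteq> b"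
    by (rule complete_edgesE)
  then have "{inv s a, inv s b} \<in> complete_edges n"
    using permutes_in_image[OF permutes_inv[OF assms]] permutes_inj[OF permutes_inv[OF assms]]
    by (simp add: complete_edges_doubleton inj_eq)
  moreover have "e = s ` {inv s a, inv s b}"
    using e permutes_inverses(1)[OF assms] by simp
  ultimately show "e \<in> (`) s ` complete_edges n" by blast
qed

lemma vertex_action_cf:
  assumes P: "P \<in> cf_partitions d n" and s: "s permutes {1..n}"
  shows "vertex_action d s P \<in> cf_partitions d n"
proof -
  let ?P = "vertex_action d s P"
  have part: "P \<in> partitions d n" using P by (simp add: cf_partitions_def)
  have inj: "inj s" "inj (inv s)" using permutes_inj[OF s] permutes_inj[OF permutes_inv[OF s]] .
  have eq: "?P i = (`) s ` P i" if "i \<in> {1..d}" for i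
    using that by (simp add: vertex_action_def)
  have "?P i \<subseteq> complete_edges n" if "i \<in> {1..d}" for i
    using image_mono[OF partitions_subset[OF part that], of "(`) s"]
    by (simp only: eq[OF that] image_complete_edges[OF s])
  then have "?P \<in> {1..d} \<rightarrow>\<^sub>E Pow (complete_edges n)"
    by (simp add: PiE_iff vertex_action_def)
  moreover have "disjoint_family_on ?P {1..d}"
    unfolding disjoint_family_on_def
  proof (intro ballI impI)
    fix i j assume ij: "i \<in> {1..d}" "j \<in> {1..d}" "i \<noteq> j"
    then have "P i \<inter> P j = {}" using partitions_disjoint[OF part] by blast
    moreover have "inj ((`) s)" using inj(1) by (intro injI) (simp add: inj_image_eq_iff)
    ultimately show "?P i \<inter> ?P j = {}"
      using ij by (simp add: eq image_Int[symmetric])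
  qed
  moreover have "(\<Union>i\<in>{1..d}. ?P i) = (`) s ` (\<Union>i\<in>{1..d}. P i)"
    using eq by (simp add: image_UN)
  then have "(\<Union>i\<in>{1..d}. ?P i) = complete_edges n"
    using part image_complete_edges[OF s] by (simp add: partitions_def)
  moreover have "\<not> has_cycle (?P i)" if i: "i \<in> {1..d}" for i
  proof
    assume "has_cycle (?P i)"
    then have "has_cycle ((`) (inv s) ` ?P i)" by (rule has_cycle_image[OF inj(2)])
    also have "(`) (inv s) ` ?P i = P i"
      using inj(1) by (simp add: eq[OF i] image_comp comp_def image_inv_f_f)
    finally show False using P i by (simp add: cf_partitions_def)
  qed
  ultimately show ?thesis unfolding cf_partitions_def partitions_def by blast
qed

section \<open>Three trees on seven vertices\<close>

text \<open>Isolates \<open>x\<close>, so that \<open>conn (del x E)\<close> between other vertices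
  means reachability avoiding \<open>x\<close>.\<close>

definition del :: "'a \<Rightarrow> 'a set set \<Rightarrow> 'a set set" where
  "del x E = {e \<in> E. x \<notin> e}"

text \<open>In a tree \<open>E\<close> not containing \<open>xy\<close>, this says that neither \<open>ux\<close> nor \<open>uy\<close> lies on the cycle
  closed by \<open>xy\<close>, i.e. that \<open>xy\<close> can be exchanged for neither of them.\<close>

definition blocked :: "nat set set \<Rightarrow> nat \<Rightarrow> nat \<Rightarrow> nat \<Rightarrow> bool" where
  "blocked E u x y \<longleftrightarrow> \<not> ({x, u} \<in> E \<and> conn (del x E) u y) \<and> \<not> ({y, u} \<in> E \<and> conn (del y E) u x)"

text \<open>Increasing pairs serve as normal forms, so that each edge and each connection becomes a
  single propositional atom.\<close>

lemma min_max_doubleton: "{min x y, max x y} = {x, y}" for x y :: nat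
  by (auto simp: min_def max_def)

lemma conn_min_max: "conn E (min x y) (max x y) \<longleftrightarrow> conn E x y" for x y :: nat
  by (auto simp: min_def max_def conn_commute)

lemma crossing_edge:
  assumes "conn E x y" "x \<in> S" "y \<notin> S"
  shows "\<exists>a\<in>S. \<exists>b. b \<notin> S \<and> {a, b} \<in> E"
  using assms(1,3) unfolding conn_def
proof (induction rule: rtranclp_induct)
  case base
  then show ?case using assms(2) by blast
next
  case (step y z)
  then show ?case by (cases "y \<in> S") auto
qed

text \<open>Spells out connectedness as one disjunction of edges per cut. Keeping \<open>v\<close>
  outside \<open>S\<close> meets every cut once, since exactly one of its two sides avoids
  \<open>v\<close>.\<close>

lemma crossing_edge_subseqs:
  fixes E :: "nat set set"
  assumes E: "\<Union>E \<subseteq> set (vs @ [v])" and conn: "\<And>x y. x \<in> set (vs @ [v]) \<Longrightarrow> y \<in> set (vs @ [v]) \<Longrightarrow>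
      conn E x y"
    and "v \<notin> set vs"
  shows "\<forall>S\<in>set (subseqs vs). S \<noteq> [] \<longrightarrow>
    (\<exists>x\<in>set S. \<exists>y\<in>set (filter (\<lambda>y. y \<notin> set S) (vs @ [v])). {min x y, max x y} \<in> E)"
proof (intro ballI impI)
  fix S assume S: "S \<in> set (subseqs vs)" "S \<noteq> []"
  then have sub: "set S \<subseteq> set vs" using subseqs_powset[of vs] by auto
  obtain x where x: "x \<in> set S" using S(2) by (cases S) auto
  have "conn E x v" using x sub by (intro conn) auto
  moreover have "v \<notin> set S" using sub assms(3) by blast
  ultimately obtain a b where ab: "a \<in> set S" "b \<notin> set S" "{a, b} \<in> E"
    using crossing_edge[of E x v "set S"] x by blast
  then have "b \<in> set (vs @ [v])" using E by blast
  with ab(2,3) have "\<exists>y\<in>set (filter (\<lambda>y. y \<notin> set S) (vs @ [v])). {min a y, max a y} \<in> E"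
    by (intro bexI[of _ b]) (auto simp: min_max_doubleton)
  with ab(1) show "\<exists>x\<in>set S. \<exists>y\<in>set (filter (\<lambda>y. y \<notin> set S) (vs @ [v])). {min x y, max x y} \<in> E"
    by blast
qed

lemma blocked_min_max:
  "blocked E u x y \<Longrightarrow> ({min x u, max x u} \<in> E \<longrightarrow> \<not> conn (del x E) (min u y) (max u y)) \<and>
     ({min y u, max y u} \<in> E \<longrightarrow> \<not> conn (del y E) (min u x) (max u x))"
  unfolding blocked_def min_max_doubleton conn_min_max by blast

text \<open>Translates the blocked state after \<open>bt\<close> has been replaced by
  \<open>ab\<close> into conditions on \<open>E\<close> itself. Deleting \<open>b\<close> removes
  both edges; deleting \<open>t\<close> leaves \<open>ab\<close> as an extra edge, so reaching
  \<open>a\<close> is as bad as reaching \<open>b\<close>.\<close>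

lemma blocked_moved_leaf:
  assumes "blocked (insert {a, b} (E - {{b, t}})) u b t" "distinct [a, b, t, u]"
  shows "({min b u, max b u} \<in> E \<longrightarrow> \<not> conn (del b E) (min u t) (max u t)) \<and>
    ({min t u, max t u} \<in> E \<longrightarrow> \<not> conn (del t E) (min u b) (max u b) \<and>
        \<not> conn (del t E) (min u a) (max u a))"
proof -
  have "del b (insert {a, b} (E - {{b, t}})) = del b E"
    and "del t (insert {a, b} (E - {{b, t}})) = insert {a, b} (del t E)"
    using assms(2) by (auto simp: del_def)
  moreover have "{b, u} \<noteq> {b, t}" "{t, u} \<noteq> {b, t}" "{b, u} \<noteq> {a, b}" "{t, u} \<noteq> {a, b}"
    using assms(2) by (auto simp: doubleton_eq_iff)
  ultimately show ?thesis
    using assms(1) unfolding blocked_def min_max_doubleton conn_min_max by (auto simp: conn_insert)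
qed

text \<open>
  Here \<open>u = 2\<close>, its leaves are 3 and 4, and \<open>xy = {5, 6}\<close>. The hypotheses \<open>leaf\<close> and \<open>centre\<close> say that the final
  exchange is still blocked after each of the two kinds of moves.
  The contradiction is purely propositional in the atoms \<open>{i, j} \<in> E\<close> and \<open>conn (del x E) i j\<close>
  with \<open>i < j\<close>; of connectedness only the edges crossing each cut and the transitivity of
  reachability avoiding a vertex are needed.
\<close>

lemma three_trees_core:
  fixes A B D :: "nat set set"
  assumes cover: "\<forall>e\<in>{{2, 5}, {2, 6}, {2, 7}, {2, 8}, {3, 4}, {3, 5}, {3, 6}, {3, 7}, {3, 8},
      {4, 5}, {4, 6}, {4, 7}, {4, 8}, {5, 7}, {5, 8}, {6, 7}, {6, 8}, {7, 8}}.
      e \<in> A \<and> e \<notin> B \<and> e \<notin> D \<or> e \<notin> A \<and> e \<in> B \<and> e \<notin> D \<or> e \<notin> A \<and> e \<notin> B \<and> e \<in> D"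
    and tree: "\<forall>e\<in>{{2, 3}, {2, 4}, {5, 6}}. e \<notin> A \<and> e \<notin> B \<and> e \<notin> D"
    and vertices: "\<And>E. E \<in> {A, B, D} \<Longrightarrow> \<Union>E \<subseteq> {2, 3, 4, 5, 6, 7, 8}"
    and connected: "\<And>E x y. E \<in> {A, B, D} \<Longrightarrow> x \<in> {2, 3, 4, 5, 6, 7, 8} \<Longrightarrow> y \<in> {2, 3, 4, 5, 6, 7, 8} \<Longrightarrow>
        conn E x y"
    and AB: "{2, 5} \<in> A" "{2, 6} \<in> B"
    and blocked: "\<And>E. E \<in> {A, B, D} \<Longrightarrow> blocked E 2 5 6"
    and leaf: "\<And>E F G a b t X. (E, F, G) \<in> {(A, B, D), (B, D, A), (D, A, B)} \<Longrightarrow>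
        (a, b) \<in> {(5, 6), (6, 5)} \<Longrightarrow> t \<in> {7, 8} \<Longrightarrow> {b, t} \<in> E \<Longrightarrow> conn (del b E) t a \<Longrightarrow>
        X \<in> {insert {a, b} (E - {{b, t}}), F, G} \<Longrightarrow> blocked X 2 b t"
    and centre: "\<And>E F G p q X. (E, F, G) \<in> {(A, B, D), (B, D, A), (D, A, B)} \<Longrightarrow>
        (p, q) \<in> {(3, 4), (4, 3)} \<Longrightarrow> {3, 4} \<in> E \<Longrightarrow> conn (del q E) 2 p \<Longrightarrow>
        X \<in> {insert {2, q} (E - {{p, q}}), F, G} \<Longrightarrow> blocked X p 5 6"
  shows False
proof -
  have "{2, 5} \<notin> B" "{2, 5} \<notin> D" "{2, 6} \<notin> A" "{2, 6} \<notin> D"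
    using cover AB by simp_all
  note [simp] = this AB tree[simplified] doubleton_eq_iff
  \<comment> \<open>After a change of centre the new edge \<open>{2, q}\<close> is present, and it
    survives the deletion of any third vertex.\<close>
  have [simp]: "conn (del x (insert {2, q} E)) 2 q" if "x \<noteq> 2" "x \<noteq> q" for x q :: nat and E
    using that by (intro conn_edge) (simp add: del_def)
  let ?V = "{2, 3, 4, 5, 6, 7, 8} :: nat set"
  \<comment> \<open>Vertex 8 is kept outside, which leaves the 63 nonempty subsets of the other six
    vertices.\<close>
  have cut: "\<forall>S\<in>set (subseqs [2, 3, 4, 5, 6, 7]). S \<noteq> [] \<longrightarrow>
    (\<exists>x\<in>set S. \<exists>y\<in>set (filter (\<lambda>y. y \<notin> set S) ([2, 3, 4, 5, 6, 7] @ [8])). {min x y, max x y} \<in> E)"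
    if "E \<in> {A, B, D}" for E
    using vertices[OF that] connected[OF that] by (intro crossing_edge_subseqs) simp_all
  have edge: "\<forall>x\<in>S. \<forall>i\<in>?V. \<forall>j\<in>?V. i < j \<longrightarrow> x \<noteq> i \<longrightarrow> x \<noteq> j \<longrightarrow>
      {i, j} \<in> E \<longrightarrow> conn (del x E) i j" for E :: "nat set set" and S
    by (auto simp: del_def intro!: conn_edge)
  have trans: "\<forall>x\<in>S. \<forall>i\<in>?V. \<forall>j\<in>?V. \<forall>k\<in>?V. i < k \<longrightarrow> i \<noteq> j \<longrightarrow> j \<noteq> k \<longrightarrow> x \<noteq> i \<longrightarrow> x \<noteq> j \<longrightarrow> x \<noteq> k \<longrightarrow>
      conn (del x E) (min i j) (max i j) \<longrightarrow> conn (del x E) (min j k) (max j k) \<longrightarrow> conn (del x E) i k"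
    for E :: "nat set set" and S
    unfolding conn_min_max by (meson conn_trans)
  have leaf': "\<forall>(a, b)\<in>{(5, 6), (6, 5)}. \<forall>t\<in>{7, 8}. {b, t} \<in> E \<longrightarrow>
      conn (del b E) (min t a) (max t a) \<longrightarrow>
      blocked (insert {a, b} (E - {{b, t}})) 2 b t \<and> blocked F 2 b t \<and> blocked G 2 b t"
    if "(E, F, G) \<in> {(A, B, D), (B, D, A), (D, A, B)}" for E F G
    unfolding conn_min_max using leaf[OF that] by blast
  have centre': "\<forall>(p, q)\<in>{(3, 4), (4, 3)}. {3, 4} \<in> E \<longrightarrow> conn (del q E) 2 p \<longrightarrow>
      blocked (insert {2, q} (E - {{p, q}})) p 5 6 \<and> blocked F p 5 6 \<and> blocked G p 5 6"
    if "(E, F, G) \<in> {(A, B, D), (B, D, A), (D, A, B)}" for E F G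
    using centre[OF that] by blast
  have moved: "\<forall>(a, b)\<in>{(5, 6), (6, 5)}. \<forall>t\<in>{7, 8}. blocked (insert {a, b} (E - {{b, t}})) 2 b t \<longrightarrow>
      ({min b 2, max b 2} \<in> E \<longrightarrow> \<not> conn (del b E) (min 2 t) (max 2 t)) \<and>
      ({min t 2, max t 2} \<in> E \<longrightarrow> \<not> conn (del t E) (min 2 b) (max 2 b) \<and>
          \<not> conn (del t E) (min 2 a) (max 2 a))"
    for E
    by (intro ballI) (auto simp del: min_less_iff_conj dest!: blocked_moved_leaf)
  have unmoved: "\<forall>(u, x, y)\<in>S. blocked E u x y \<longrightarrow>
     ({min x u, max x u} \<in> E \<longrightarrow> \<not> conn (del x E) (min u y) (max u y)) \<and>
     ({min y u, max y u} \<in> E \<longrightarrow> \<not> conn (del y E) (min u x) (max u x))" for E S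
    using blocked_min_max by blast
  \<comment> \<open>\<open>?S\<close> lists the triples for which an unchanged tree has to be
    blocked: those of the present position, of the four moves of the edge \<open>{5, 6}\<close> and
    of the two new centres. \<open>?X\<close> holds the vertices whose deletion from an original
    tree is considered. \<open>?re\<close> is the tree changed by a move of the centre; for it only
    the deletion of 5 or 6 matters, as its blocking triple ends in these.\<close>
  let ?S = "{(2, 5, 6), (2, 5, 7), (2, 5, 8), (2, 6, 7), (2, 6, 8), (3, 5, 6), (4, 5, 6)}"
  let ?X = "{3, 4, 5, 6, 7, 8}"
  let ?re = "\<lambda>E p q. insert {2, q} (E - {{p, q}})"
  note clauses = cover[simplified]
    cut[of A, simplified] edge[of ?X A, simplified] trans[of ?X A, simplified]
    moved[of A, simplified] unmoved[of ?S A, simplified] blocked[of A, simplified]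
    cut[of B, simplified] edge[of ?X B, simplified] trans[of ?X B, simplified]
    moved[of B, simplified] unmoved[of ?S B, simplified] blocked[of B, simplified]
    cut[of D, simplified] edge[of ?X D, simplified] trans[of ?X D, simplified]
    moved[of D, simplified] unmoved[of ?S D, simplified] blocked[of D, simplified]
    leaf'[of A B D, simplified] centre'[of A B D, simplified]
    leaf'[of B D A, simplified] centre'[of B D A, simplified]
    leaf'[of D A B, simplified] centre'[of D A B, simplified]
    edge[of "{5, 6}" "?re A 3 4", simplified] trans[of "{5, 6}" "?re A 3 4", simplified]
    unmoved[of "{(3, 5, 6)}" "?re A 3 4", simplified]
    edge[of "{5, 6}" "?re A 4 3", simplified] trans[of "{5, 6}" "?re A 4 3", simplified]
    unmoved[of "{(4, 5, 6)}" "?re A 4 3", simplified]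
    edge[of "{5, 6}" "?re B 3 4", simplified] trans[of "{5, 6}" "?re B 3 4", simplified]
    unmoved[of "{(3, 5, 6)}" "?re B 3 4", simplified]
    edge[of "{5, 6}" "?re B 4 3", simplified] trans[of "{5, 6}" "?re B 4 3", simplified]
    unmoved[of "{(4, 5, 6)}" "?re B 4 3", simplified]
    edge[of "{5, 6}" "?re D 3 4", simplified] trans[of "{5, 6}" "?re D 3 4", simplified]
    unmoved[of "{(3, 5, 6)}" "?re D 3 4", simplified]
    edge[of "{5, 6}" "?re D 4 3", simplified] trans[of "{5, 6}" "?re D 4 3", simplified]
    unmoved[of "{(4, 5, 6)}" "?re D 4 3", simplified]
  show False using clauses using [[argo_timeout = 600]] by argo
qed

section \<open>Moves between copies of the tree\<close>

text \<open>Each step relabels the vertices before the flip, so that intermediate fourth trees can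
  always be brought to one normal form.\<close>

inductive reaches_TS4 :: "(nat \<Rightarrow> nat set set) \<Rightarrow> bool" where
  goal: "P \<in> cf_partitions 4 8 \<Longrightarrow> graph_isomorphic 8 (P 4) TS4 \<Longrightarrow> reaches_TS4 P"
| step: "P \<in> cf_partitions 4 8 \<Longrightarrow> s permutes {1..8} \<Longrightarrow> flip 4 (vertex_action 4 s P) Q \<Longrightarrow>
    reaches_TS4 Q \<Longrightarrow> reaches_TS4 P"

lemma reaches_TS4D:
  assumes "reaches_TS4 P"
  shows "\<exists>Q\<in>cf_partitions 4 8. graph_isomorphic 8 (Q 4) TS4 \<and> weakly_equivalent 4 P Q"
  using assms
proof induction
  case (goal P)
  then show ?case using weakly_equivalent_refl[of P 4] by auto
next
  case (step P s Q)
  then show ?case using weakly_equivalent_flip[of P 4 s Q] by auto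
qed

lemma inj_image_image: "inj f \<Longrightarrow> inj ((`) f)"
  by (intro injI) (simp add: inj_image_eq_iff)

lemma graph_isomorphic_image:
  assumes s: "s permutes {1..n}"
  shows "graph_isomorphic n ((`) s ` E) F \<longleftrightarrow> graph_isomorphic n E F"
proof -
  have inj: "inj s" using s by (rule permutes_inj)
  have mem: "{s i, s j} \<in> (`) s ` E \<longleftrightarrow> {i, j} \<in> E" for i j
  proof -
    have "{s i, s j} \<in> (`) s ` E \<longleftrightarrow> s ` {i, j} \<in> (`) s ` E" by simp
    also have "\<dots> \<longleftrightarrow> {i, j} \<in> E"
      using inj_image_image[OF inj] by (rule inj_image_mem_iff)
    finally show ?thesis .
  qed
  show ?thesis
  proof
    assume "graph_isomorphic n ((`) s ` E) F"
    then obtain f where f: "bij_betw f {1..n} {1..n}"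
      "\<forall>i\<in>{1..n}. \<forall>j\<in>{1..n}. {i, j} \<in> (`) s ` E \<longleftrightarrow> {f i, f j} \<in> F"
      unfolding graph_isomorphic_def by blast
    have "{i, j} \<in> E \<longleftrightarrow> {(f \<circ> s) i, (f \<circ> s) j} \<in> F" if "i \<in> {1..n}" "j \<in> {1..n}" for i j
      using f(2)[rule_format, of "s i" "s j"] permutes_in_image[OF s] that mem by simp
    moreover have "bij_betw (f \<circ> s) {1..n} {1..n}"
      using permutes_imp_bij[OF s] f(1) by (rule bij_betw_trans)
    ultimately show "graph_isomorphic n E F" unfolding graph_isomorphic_def by blast
  next
    assume "graph_isomorphic n E F"
    then obtain f where f: "bij_betw f {1..n} {1..n}"
      "\<forall>i\<in>{1..n}. \<forall>j\<in>{1..n}. {i, j} \<in> E \<longleftrightarrow> {f i, f j} \<in> F"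
      unfolding graph_isomorphic_def by blast
    have "{i, j} \<in> (`) s ` E \<longleftrightarrow> {(f \<circ> inv s) i, (f \<circ> inv s) j} \<in> F" if "i \<in> {1..n}" "j \<in> {1..n}"
        for i j
      using f(2)[rule_format, of "inv s i" "inv s j"] permutes_in_image[OF permutes_inv[OF s]] that
        mem[of "inv s i" "inv s j"] permutes_inverses[OF s] by simp
    moreover have "bij_betw (f \<circ> inv s) {1..n} {1..n}"
      using permutes_imp_bij[OF permutes_inv[OF s]] f(1) by (rule bij_betw_trans)
    ultimately show "graph_isomorphic n ((`) s ` E) F" unfolding graph_isomorphic_def by blast
  qed
qed

text \<open>The relabelling merges with the one at the front of the next step, or is absorbed by the
  isomorphism with \<open>TS4\<close> if no step follows.\<close>

lemma reaches_TS4_relabel: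
  assumes P: "P \<in> cf_partitions 4 8" and s: "s permutes {1..8}"
    and "reaches_TS4 (vertex_action 4 s P)"
  shows "reaches_TS4 P"
  using assms(3)
proof cases
  case goal
  then have "graph_isomorphic 8 (P 4) TS4"
    using graph_isomorphic_image[OF s] by (simp add: vertex_action_def)
  with P show ?thesis by (rule reaches_TS4.goal)
next
  case (step t Q)
  have ts: "t \<circ> s permutes {1..8}" using s step(2) by (rule permutes_compose)
  have "flip 4 (vertex_action 4 (t \<circ> s) P) Q"
    using step(3) by (simp only: vertex_action_comp)
  with P ts show ?thesis using step(4) by (rule reaches_TS4.step)
qed

lemma (in exchangeable) reaches_TS4_exchange:
  assumes "d = 4" "reaches_TS4 Q"
  shows "reaches_TS4 P"
proof (rule reaches_TS4.step)
  show "P \<in> cf_partitions 4 8" using P assms(1) by simp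
  show "id permutes {1..8}" by (rule permutes_id)
  have "vertex_action 4 id P = P" using part assms(1) by (simp add: vertex_action_id)
  then show "flip 4 (vertex_action 4 id P) Q" using flip_exchange assms(1) by simp
qed (rule assms)

section \<open>Transport along relabellings that are involutions\<close>

lemma conn_image:
  assumes "conn E x y"
  shows "conn ((`) s ` E) (s x) (s y)"
  using assms unfolding conn_def[of E]
proof (induction rule: rtranclp_induct)
  case (step y z)
  have "s ` {y, z} \<in> (`) s ` E" using step(2) by (rule imageI)
  then have "conn ((`) s ` E) (s y) (s z)" by (simp add: conn_edge)
  with step(3) show ?case by (rule conn_trans)
qed simp

lemma image_image_involution:
  assumes "s \<circ> s = id"
  shows "(`) s ` (`) s ` E = E"
proof -
  have "s (s w) = w" for w using fun_cong[OF assms, of w] by simp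
  then show ?thesis by (simp add: image_image)
qed

lemma conn_image_iff:
  assumes "s \<circ> s = id"
  shows "conn ((`) s ` E) x y \<longleftrightarrow> conn E (s x) (s y)"
proof -
  have "s (s w) = w" for w using fun_cong[OF assms, of w] by simp
  then show ?thesis
    using conn_image[of "(`) s ` E" x y s] conn_image[of E "s x" "s y" s] image_image_involution[OF
        assms]
    by auto
qed

lemma mem_image_iff:
  assumes "s \<circ> s = id"
  shows "e \<in> (`) s ` E \<longleftrightarrow> s ` e \<in> E"
proof -
  have "s (s w) = w" for w using fun_cong[OF assms, of w] by simp
  then have "s ` s ` A = A" for A by (simp add: image_image)
  then show ?thesis by (metis imageE imageI)
qed

lemma del_image:
  assumes "s \<circ> s = id"
  shows "del x ((`) s ` E) = (`) s ` del (s x) E"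
proof -
  have "s (s w) = w" for w using fun_cong[OF assms, of w] by simp
  then have "x \<in> s ` e \<longleftrightarrow> s x \<in> e" for e by (metis imageE imageI)
  then show ?thesis unfolding del_def by blast
qed

lemma blocked_image:
  assumes "s \<circ> s = id"
  shows "blocked ((`) s ` E) u x y \<longleftrightarrow> blocked E (s u) (s x) (s y)"
  unfolding blocked_def by (simp add: assms mem_image_iff conn_image_iff del_image)

text \<open>After the deletion \<open>v\<close> is isolated, so restoring its only possible edge
  \<open>vw\<close> cannot help to connect two other vertices.\<close>

lemma conn_del_leaf:
  assumes "conn E a b" "\<And>e. e \<in> E \<Longrightarrow> v \<in> e \<Longrightarrow> e = {v, w}" "a \<noteq> v" "b \<noteq> v"
  shows "conn (del v E) a b"
proof -
  have iso: "\<not> conn (del v E) x v" if "x \<noteq> v" for x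
  proof
    assume "conn (del v E) x v"
    then show False unfolding conn_def
      by (cases rule: rtranclp.cases) (use that in \<open>auto simp: del_def\<close>)
  qed
  have "E \<subseteq> insert {v, w} (del v E)" using assms(2) by (auto simp: del_def)
  with assms(1) have "conn (insert {v, w} (del v E)) a b" by (rule conn_mono)
  then show ?thesis using iso[OF assms(3)] iso[OF assms(4)]
    by (auto simp: conn_insert conn_commute)
qed

text \<open>The edges at 1 outside the fourth tree go to 3, 4 and 6. Each of the three other
  spanning trees needs one of them, so each has exactly one.\<close>

lemma hub_is_leaf:
  assumes P: "P \<in> cf_partitions 4 8" and hub: "\<And>w. {1, w} \<in> P 4 \<longleftrightarrow> w \<in> {2, 5, 7, 8}"
    and c: "c \<in> {1, 2, 3}"
  shows "\<exists>w. \<forall>e\<in>P c. 1 \<in> e \<longrightarrow> e = {1, w}"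
proof -
  have part: "P \<in> partitions 4 8" using P by (simp add: cf_partitions_def)
  have range: "b \<in> {3, 4, 6}" if "{1, b} \<in> P i" "i \<in> {1, 2, 3}" for b i
  proof -
    have i: "i \<in> {1..4}" "i \<noteq> 4" using that(2) by auto
    then have "{1, b} \<in> complete_edges 8" using partitions_subset[OF part] that(1) by blast
    then have "b \<in> {1..8}" "b \<noteq> 1" by (simp_all add: complete_edges_doubleton)
    moreover have "{1, b} \<notin> P 4" using partitions_disjoint[OF part i(1), of 4] that(1) i(2) by auto
    then have "b \<notin> {2, 5, 7, 8}" using hub by blast
    ultimately show ?thesis by auto
  qed
  have "\<exists>w. {1, w} \<in> P i" if "i \<in> {1, 2, 3}" for i
  proof -
    have "spanning 8 (P i)" using spanning_part[of P 4 i] P that by auto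
    then have "conn (P i) 1 2" by (simp add: spanning_def)
    from crossing_edge[OF this, of "{1}"] show ?thesis by auto
  qed
  then obtain w where w: "\<And>i. i \<in> {1, 2, 3} \<Longrightarrow> {1, w i} \<in> P i" by metis
  have inj: "inj_on w {1, 2, 3}"
  proof (rule inj_onI)
    fix i j :: nat assume ij: "i \<in> {1, 2, 3}" "j \<in> {1, 2, 3}" "w i = w j"
    then have "{1, w i} \<in> P i" "{1, w i} \<in> P j" using w by metis+
    then show "i = j" using partitions_disjoint[OF part, of i j] ij by auto
  qed
  have "w ` {1, 2, 3} = {3, 4, 6}"
  proof (rule card_subset_eq)
    show "w ` {1, 2, 3} \<subseteq> {3, 4, 6}" using range w by blast
    show "card (w ` {1, 2, 3}) = card {3, 4, 6 :: nat}" using card_image[OF inj] by simp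
  qed simp
  have "e = {1, w c}" if e: "e \<in> P c" "1 \<in> e" for e
  proof -
    have c4: "c \<in> {1..4}" using c by auto
    then have "e \<in> complete_edges 8" using partitions_subset[OF part] e(1) by blast
    then obtain b where b: "e = {1, b}"
      using e(2) by (auto elim!: complete_edgesE simp: insert_commute)
    then have "b \<in> w ` {1, 2, 3}" using range e(1) c \<open>w ` {1, 2, 3} = {3, 4, 6}\<close> by blast
    then obtain i where i: "i \<in> {1, 2, 3}" "b = w i" by blast
    then have "e \<in> P i" using w b by simp
    then have "i = c" using partitions_disjoint[OF part, of i c] i(1) c4 e(1) by auto
    then show ?thesis using b i by simp
  qed
  then show ?thesis by blast
qed

lemma conn_del_hub:
  assumes P: "P \<in> cf_partitions 4 8" and hub: "\<And>w. {1, w} \<in> P 4 \<longleftrightarrow> w \<in> {2, 5, 7, 8}"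
    and c: "c \<in> {1, 2, 3}" and ab: "a \<in> {2..8}" "b \<in> {2..8}"
  shows "conn (del 1 (P c)) a b"
proof -
  obtain w where w: "\<And>e. e \<in> P c \<Longrightarrow> 1 \<in> e \<Longrightarrow> e = {1, w}"
    using hub_is_leaf[OF P hub c] by blast
  have "spanning 8 (P c)" using spanning_part[of P 4 c] P c by auto
  then have "conn (P c) a b" using ab by (simp add: spanning_def)
  then show ?thesis using w ab by (intro conn_del_leaf) auto
qed

lemma del_subset: "del x E \<subseteq> E"
  by (auto simp: del_def)

lemma conn_path3: "{a, b} \<in> E \<Longrightarrow> {b, c} \<in> E \<Longrightarrow> {c, d} \<in> E \<Longrightarrow> conn E a d"
  by (meson conn_edge conn_trans)

lemma conn_path2: "{a, b} \<in> E \<Longrightarrow> {b, c} \<in> E \<Longrightarrow> conn E a c"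
  by (meson conn_edge conn_trans)

text \<open>A copy of \<^const>\<open>T19\<close> in which the vertex of degree four is 1.\<close>

definition T0 :: "nat set set" where
  "T0 = {{1, 2}, {2, 3}, {2, 4}, {1, 5}, {5, 6}, {1, 7}, {1, 8}}"

text \<open>Forgetting the edges at 1 is harmless, because 1 is a leaf of the three trees.\<close>

definition stuck :: "(nat \<Rightarrow> nat set set) \<Rightarrow> bool" where
  "stuck C \<longleftrightarrow> (\<exists>P\<in>cf_partitions 4 8. P 4 = T0 \<and> \<not> reaches_TS4 P \<and> (\<forall>c\<in>{1, 2, 3}. C c = del 1 (P c)))"

lemma stuckE:
  assumes "stuck C"
  obtains P where "P \<in> cf_partitions 4 8" "P 4 = T0" "\<not> reaches_TS4 P"
    "\<And>c. c \<in> {1, 2, 3} \<Longrightarrow> C c = del 1 (P c)"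
  using assms unfolding stuck_def by blast

lemma T0_hub: "{1, w} \<in> T0 \<longleftrightarrow> w \<in> {2, 5, 7, 8}"
  by (auto simp: T0_def doubleton_eq_iff)

text \<open>Brings the result of an exchange back to normal form. As \<open>s\<close> fixes 1,
  relabelling commutes with the deletion of vertex 1.\<close>

lemma stuckI:
  assumes Q: "Q \<in> cf_partitions 4 8" "\<not> reaches_TS4 Q"
      and s: "s permutes {1..8}" "s \<circ> s = id" "s 1 = 1"
    and T0: "(`) s ` Q 4 = T0" and C: "\<And>c. c \<in> {1, 2, 3} \<Longrightarrow> C c = (`) s ` del 1 (Q c)"
  shows "stuck C"
  unfolding stuck_def
proof (intro bexI conjI ballI)
  show "vertex_action 4 s Q \<in> cf_partitions 4 8" using Q(1) s(1) by (rule vertex_action_cf)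
  show "vertex_action 4 s Q 4 = T0" using T0 by (simp add: vertex_action_def)
  show "\<not> reaches_TS4 (vertex_action 4 s Q)" using reaches_TS4_relabel[OF Q(1) s(1)] Q(2) by blast
  fix c :: nat assume c: "c \<in> {1, 2, 3}"
  then have "vertex_action 4 s Q c = (`) s ` Q c" by (auto simp: vertex_action_def)
  then show "C c = del 1 (vertex_action 4 s Q c)" using C[OF c] s(3) by (simp
      add: del_image[OF s(2)])
qed

section \<open>Symmetries and moves of stuck configurations\<close>

lemma transpose_involution: "transpose a b \<circ> transpose a b = id"
  by (simp add: fun_eq_iff transpose_def)

lemma stuck_relabel:
  assumes "stuck C" and s: "s permutes {1..8}" "s \<circ> s = id" "s 1 = 1" "(`) s ` T0 = T0"
  shows "stuck (\<lambda>c. (`) s ` C c)"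
proof -
  obtain P where P: "P \<in> cf_partitions 4 8" "P 4 = T0" "\<not> reaches_TS4 P"
    and C: "\<And>c. c \<in> {1, 2, 3} \<Longrightarrow> C c = del 1 (P c)" using assms(1) by (rule stuckE) blast
  show ?thesis using P(1,3) s(1-3) by (rule stuckI) (simp_all add: P(2) s(4) C)
qed

text \<open>Vertices 3 and 4 are both leaves at 2, so swapping them is an automorphism of
  \<open>T0\<close>; the same holds for the leaves 7 and 8 at 1.\<close>

lemma stuck_transpose_34: "stuck C \<Longrightarrow> stuck (\<lambda>c. (`) (transpose 3 4) ` C c)"
  by (rule stuck_relabel, assumption, rule permutes_swap_id, simp, simp, rule transpose_involution,
      simp, rule equalityI) (simp_all add: T0_def transpose_def doubleton_eq_iff)

lemma stuck_transpose_78: "stuck C \<Longrightarrow> stuck (\<lambda>c. (`) (transpose 7 8) ` C c)"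
  by (rule stuck_relabel, assumption, rule permutes_swap_id, simp, simp, rule transpose_involution,
      simp, rule equalityI) (simp_all add: T0_def transpose_def doubleton_eq_iff)

lemma vertices_8: "{1..8} = {1, 2, 3, 4, 5, 6, 7, 8 :: nat}"
  by auto

text \<open>The new graph is a twin star with adjacent centres 1 and 2, whose leaves are 5, 7, 8 and
  3, 4, 6.\<close>

lemma isomorphic_TS4: "graph_isomorphic 8 (insert {6, 2} (T0 - {{6, 5}})) TS4"
proof -
  let ?f = "\<lambda>x. [0, 1, 2, 4, 6, 3, 8, 5, 7] ! x :: nat"
  have "insert {6, 2} (T0 - {{6, 5}}) = {{6, 2}, {1, 2}, {2, 3}, {2, 4}, {1, 5}, {1, 7}, {1, 8}}"
    by (simp add: T0_def insert_Diff_if doubleton_eq_iff)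
  moreover have "bij_betw ?f {1..8} {1..8}"
    unfolding vertices_8 by
        (rule bij_betw_byWitness[of _ "\<lambda>x. [0, 1, 2, 5, 3, 7, 4, 8, 6] ! x"]) simp_all
  ultimately show ?thesis
    unfolding graph_isomorphic_def vertices_8
    by (intro exI[of _ ?f]) (simp add: TS4_def doubleton_eq_iff)
qed

text \<open>The cycle that \<open>{5, 6}\<close> closes in tree \<open>c\<close> contains
  \<open>{6, 2}\<close>, so these edges can be traded between this tree and the fourth one, which
  then becomes a copy of \<open>TS4\<close>.\<close>

lemma stuck_not_next_to_goal:
  assumes "stuck C" and c: "c \<in> {1, 2, 3}" and e: "{6, 2} \<in> C c" "conn (del 6 (C c)) 2 5"
  shows False
proof -
  obtain P where P: "P \<in> cf_partitions 4 8" "P 4 = T0" "\<not> reaches_TS4 P"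
    and C: "\<And>c. c \<in> {1, 2, 3} \<Longrightarrow> C c = del 1 (P c)" using assms(1) by (rule stuckE) blast
  have "conn (insert {6, 5} (P c - {{6, 2}})) 2 5"
    using e(2) by (rule conn_mono) (auto simp: C[OF c] del_def)
  then have "conn (insert {6, 5} (P c - {{6, 2}})) 6 2"
    by (meson conn_edge conn_sym conn_trans insertI1)
  \<comment> \<open>In the fourth tree the new edge lies on the path 6, 2, 1, 5.\<close>
  moreover have "conn (insert {6, 2} (P 4 - {{6, 5}})) 6 5"
    unfolding P(2) by (rule conn_path3[of _ 2 _ 1]) (simp_all add: T0_def doubleton_eq_iff)
  moreover have "{6, 2} \<in> P c" using e(1) by (simp add: C[OF c] del_def)
  moreover have "{6, 5} \<in> P 4" by (simp add: P(2) T0_def doubleton_eq_iff)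
  ultimately interpret ex: exchangeable 4 P 4 c 6 5 2
    using P(1) c by unfold_locales auto
  let ?Q = "exchange P 4 c {6, 5} {6, 2}"
  have "?Q 4 = insert {6, 2} (T0 - {{6, 5}})" by (simp only: ex.exchange_simps P(2))
  then have "graph_isomorphic 8 (?Q 4) TS4" using isomorphic_TS4 by simp
  then have "reaches_TS4 ?Q" using ex.exchange_cf by (auto intro: reaches_TS4.goal)
  then show False using ex.reaches_TS4_exchange P(3) by simp
qed

lemma del_exchange:
  assumes "x \<in> e" "x \<in> f"
  shows "del x (insert e (E - {f})) = del x E"
  using assms by (auto simp: del_def)

lemma del_insert_Diff:
  assumes "x \<notin> e"
  shows "del x (insert e (E - {f})) = insert e (del x E - {f})"
  using assms by (auto simp: del_def)

text \<open>This swap is no automorphism of \<open>T0\<close>. It is realised by trading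
  \<open>{1, 5}\<close> for the edge \<open>{1, 6}\<close> of some tree \<open>k\<close>; both edges
  contain 1, so the trees without vertex 1 do not change.\<close>

lemma stuck_transpose_56:
  assumes "stuck C"
  shows "stuck (\<lambda>c. (`) (transpose 5 6) ` C c)"
proof -
  obtain P where P: "P \<in> cf_partitions 4 8" "P 4 = T0" "\<not> reaches_TS4 P"
    and C: "\<And>c. c \<in> {1, 2, 3} \<Longrightarrow> C c = del 1 (P c)" using assms by (rule stuckE) blast
  have hub: "{1, w} \<in> P 4 \<longleftrightarrow> w \<in> {2, 5, 7, 8}" for w unfolding P(2) by (rule T0_hub)
  have part: "P \<in> partitions 4 8" using P by (simp add: cf_partitions_def)
  have "{1, 6} \<in> complete_edges 8" by (simp add: complete_edges_doubleton)
  then obtain k where k: "k \<in> {1..4}" "{1, 6} \<in> P k" by (rule partitions_cover[OF part])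
  then have "k \<noteq> 4" using hub[of 6] by auto
  with k have k3: "k \<in> {1, 2, 3}" by auto
  have "conn (insert {1, 5} (P k - {{1, 6}})) 5 6"
    using conn_del_hub[OF P(1) hub k3, of 5 6] by (rule conn_mono) (auto simp: del_def)
  then have "conn (insert {1, 5} (P k - {{1, 6}})) 1 6"
    by (meson conn_edge conn_trans insertI1)
  moreover have "conn (insert {1, 6} (P 4 - {{1, 5}})) 1 5"
    unfolding P(2) by (rule conn_path2[of _ 6]) (simp_all add: T0_def doubleton_eq_iff)
  moreover have "{1, 5} \<in> P 4" by (simp add: P(2) T0_def)
  ultimately interpret ex: exchangeable 4 P 4 k 1 5 6
    using P(1) k \<open>k \<noteq> 4\<close> by unfold_locales auto
  let ?Q = "exchange P 4 k {1, 5} {1, 6}"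
  have Q4: "?Q 4 = insert {1, 6} (T0 - {{1, 5}})" by (simp only: ex.exchange_simps P(2))
  have Qc: "del 1 (?Q c) = C c" if "c \<in> {1, 2, 3}" for c
  proof (cases "c = k")
    case True
    then show ?thesis using C[OF that] by (simp del: One_nat_def
        add: ex.exchange_simps(2) del_exchange)
  next
    case False
    moreover have "c \<noteq> 4" using that by auto
    ultimately show ?thesis using C[OF that] by (simp del: One_nat_def add: ex.exchange_simps(3))
  qed
  show ?thesis
  proof (rule stuckI[of ?Q])
    show "?Q \<in> cf_partitions 4 8" using ex.exchange_cf by simp
    show "\<not> reaches_TS4 ?Q" using ex.reaches_TS4_exchange P(3) by blast
    show "(`) (transpose 5 6) ` ?Q 4 = T0"
      unfolding Q4 by (rule equalityI) (simp_all
          add: T0_def transpose_def insert_Diff_if doubleton_eq_iff)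
  qed (simp_all del: One_nat_def
      add: Qc transpose_involution permutes_swap_id transpose_apply_other)
qed

text \<open>The two ways of reaching the goal, through \<open>{2, 6}\<close> or through
  \<open>{2, 5}\<close>, are interchanged by the swap of 5 and 6.\<close>

lemma stuck_blocked:
  assumes "stuck C" "c \<in> {1, 2, 3}"
  shows "blocked (C c) 2 5 6"
proof -
  have "\<not> ({6, 2} \<in> C c \<and> conn (del 6 (C c)) 2 5)"
    using stuck_not_next_to_goal[OF assms] by blast
  moreover have "\<not> ({5, 2} \<in> C c \<and> conn (del 5 (C c)) 2 6)"
  proof
    assume "{5, 2} \<in> C c \<and> conn (del 5 (C c)) 2 6"
    then show False
      by (intro stuck_not_next_to_goal[OF stuck_transpose_56[OF assms(1)] assms(2)])
        (simp_all add: mem_image_iff conn_image_iff del_image transpose_involution)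
  qed
  ultimately show ?thesis unfolding blocked_def by blast
qed

text \<open>Trading \<open>{5, 6}\<close> for \<open>{6, 7}\<close> hangs the leaf 6 on 7. The
  fourth tree becomes \<open>T0\<close> with 5 and 7 swapped, so \<open>stuck_blocked\<close>
  applies again.\<close>

lemma stuck_leaf:
  assumes "stuck C" and c: "c \<in> {1, 2, 3}" and e: "{6, 7} \<in> C c" "conn (del 6 (C c)) 7 5"
    and d: "d \<in> {1, 2, 3}"
  shows "blocked ((C(c := insert {5, 6} (C c - {{6, 7}}))) d) 2 6 7"
proof -
  obtain P where P: "P \<in> cf_partitions 4 8" "P 4 = T0" "\<not> reaches_TS4 P"
    and C: "\<And>c. c \<in> {1, 2, 3} \<Longrightarrow> C c = del 1 (P c)" using assms(1) by (rule stuckE) blast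
  have "conn (insert {6, 5} (P c - {{6, 7}})) 5 7"
    using conn_sym[OF e(2)] by (rule conn_mono) (auto simp: C[OF c] del_def)
  then have "conn (insert {6, 5} (P c - {{6, 7}})) 6 7"
    by (meson conn_edge conn_trans insertI1)
  moreover have "conn (insert {6, 7} (P 4 - {{6, 5}})) 6 5"
    unfolding P(2) by (rule conn_path3[of _ 7 _ 1]) (simp_all add: T0_def doubleton_eq_iff)
  moreover have "{6, 7} \<in> P c" using e(1) by (simp add: C[OF c] del_def)
  moreover have "{6, 5} \<in> P 4" by (simp add: P(2) T0_def doubleton_eq_iff)
  ultimately interpret ex: exchangeable 4 P 4 c 6 5 7
    using P(1) c by unfold_locales auto
  let ?Q = "exchange P 4 c {6, 5} {6, 7}"
  have Q4: "?Q 4 = insert {6, 7} (T0 - {{6, 5}})" by (simp only: ex.exchange_simps P(2))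
  let ?D = "C(c := insert {5, 6} (C c - {{6, 7}}))"
  have Qc: "del 1 (?Q i) = ?D i" if "i \<in> {1, 2, 3}" for i
  proof (cases "i = c")
    case True
    then show ?thesis
      using C[OF that] by (simp del: One_nat_def add: ex.exchange_simps(2) del_insert_Diff) (simp
          add: insert_commute)
  next
    case False
    moreover have "i \<noteq> 4" using that by auto
    ultimately show ?thesis using C[OF that] by (simp del: One_nat_def add: ex.exchange_simps(3))
  qed
  have "stuck (\<lambda>c. (`) (transpose 5 7) ` ?D c)"
  proof (rule stuckI[of ?Q])
    show "?Q \<in> cf_partitions 4 8" using ex.exchange_cf by simp
    show "\<not> reaches_TS4 ?Q" using ex.reaches_TS4_exchange P(3) by blast
    show "(`) (transpose 5 7) ` ?Q 4 = T0"
      unfolding Q4 by (rule equalityI) (simp_all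
          add: T0_def transpose_def insert_Diff_if doubleton_eq_iff)
  qed (simp_all del: One_nat_def
      add: Qc transpose_involution permutes_swap_id transpose_apply_other)
  \<comment> \<open>\<open>blocked\<close> is symmetric in its last two arguments, so the order 7, 6
    obtained here may be reversed.\<close>
  from stuck_blocked[OF this d] have "blocked (?D d) 2 7 6"
    by (simp only: blocked_image transpose_involution) (simp add: transpose_def)
  then show ?thesis unfolding blocked_def by blast
qed

text \<open>Two exchanges make 3 the vertex of degree three: \<open>{2, 4}\<close> gives way to
  \<open>{3, 4}\<close>, then \<open>{1, 2}\<close> to \<open>{1, 3}\<close>. The result is
  \<open>T0\<close> with 2 and 3 swapped, and only the first exchange is visible after deleting
  1.\<close>

lemma stuck_centre:
  assumes "stuck C" and c: "c \<in> {1, 2, 3}" and e: "{3, 4} \<in> C c" "conn (del 4 (C c)) 2 3"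
    and d: "d \<in> {1, 2, 3}"
  shows "blocked ((C(c := insert {2, 4} (C c - {{3, 4}}))) d) 3 5 6"
proof -
  obtain P where P: "P \<in> cf_partitions 4 8" "P 4 = T0" "\<not> reaches_TS4 P"
    and C: "\<And>c. c \<in> {1, 2, 3} \<Longrightarrow> C c = del 1 (P c)" using assms(1) by (rule stuckE) blast
  have "conn (insert {4, 2} (P c - {{4, 3}})) 2 3"
    using e(2) by (rule conn_mono) (auto simp: C[OF c] del_def)
  then have "conn (insert {4, 2} (P c - {{4, 3}})) 4 3"
    by (meson conn_edge conn_trans insertI1)
  moreover have "conn (insert {4, 3} (P 4 - {{4, 2}})) 4 2"
    unfolding P(2) by (rule conn_path2[of _ 3]) (simp_all add: T0_def doubleton_eq_iff)
  moreover have "{4, 3} \<in> P c" using e(1) by (simp add: C[OF c] del_def insert_commute)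
  moreover have "{4, 2} \<in> P 4" by (simp add: P(2) T0_def doubleton_eq_iff)
  ultimately interpret ex: exchangeable 4 P 4 c 4 2 3
    using P(1) c by unfold_locales auto
  let ?Q = "exchange P 4 c {4, 2} {4, 3}"
  have Q: "?Q \<in> cf_partitions 4 8" using ex.exchange_cf by simp
  have nQ: "\<not> reaches_TS4 ?Q" using ex.reaches_TS4_exchange P(3) by blast
  have Q4: "?Q 4 = insert {4, 3} (T0 - {{4, 2}})" by (simp only: ex.exchange_simps P(2))
  let ?D = "C(c := insert {2, 4} (C c - {{3, 4}}))"
  have Qc: "del 1 (?Q i) = ?D i" if "i \<in> {1, 2, 3}" for i
  proof (cases "i = c")
    case True
    then show ?thesis
      using C[OF that] by (simp del: One_nat_def add: ex.exchange_simps(2) del_insert_Diff) (simp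
          add: insert_commute)
  next
    case False
    moreover have "i \<noteq> 4" using that by auto
    ultimately show ?thesis using C[OF that] by (simp del: One_nat_def add: ex.exchange_simps(3))
  qed
  \<comment> \<open>Vertex 1 keeps its four neighbours in the first exchange, so it is still a leaf
    of the other trees.\<close>
  have hub: "{1, w} \<in> ?Q 4 \<longleftrightarrow> w \<in> {2, 5, 7, 8}" for w
    unfolding Q4 using T0_hub[of w] by (simp add: doubleton_eq_iff)
  have part: "?Q \<in> partitions 4 8" using Q by (simp add: cf_partitions_def)
  have "{1, 3} \<in> complete_edges 8" by (simp add: complete_edges_doubleton)
  then obtain k where k: "k \<in> {1..4}" "{1, 3} \<in> ?Q k" by (rule partitions_cover[OF part])
  then have "k \<noteq> 4" using hub[of 3] by auto
  with k have k3: "k \<in> {1, 2, 3}" by auto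
  have "conn (insert {1, 2} (?Q k - {{1, 3}})) 2 3"
    using conn_del_hub[OF Q hub k3, of 2 3] by (rule conn_mono) (auto simp: del_def)
  then have "conn (insert {1, 2} (?Q k - {{1, 3}})) 1 3"
    by (meson conn_edge conn_trans insertI1)
  moreover have "conn (insert {1, 3} (?Q 4 - {{1, 2}})) 1 2"
    unfolding Q4 by (rule conn_path2[of _ 3]) (simp_all add: T0_def doubleton_eq_iff)
  moreover have "{1, 2} \<in> ?Q 4" using hub by blast
  ultimately interpret ex': exchangeable 4 ?Q 4 k 1 2 3
    using Q k \<open>k \<noteq> 4\<close> by unfold_locales auto
  let ?R = "exchange ?Q 4 k {1, 2} {1, 3}"
  have R4: "?R 4 = insert {1, 3} (insert {4, 3} (T0 - {{4, 2}}) - {{1, 2}})"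
    by (simp only: ex'.exchange_simps Q4)
  have Rc: "del 1 (?R i) = ?D i" if "i \<in> {1, 2, 3}" for i
  proof (cases "i = k")
    case True
    then show ?thesis using Qc[OF that] by (simp del: One_nat_def
        add: ex'.exchange_simps(2) del_exchange)
  next
    case False
    moreover have "i \<noteq> 4" using that by auto
    ultimately show ?thesis using Qc[OF that] by (simp del: One_nat_def add: ex'.exchange_simps(3))
  qed
  have "stuck (\<lambda>c. (`) (transpose 2 3) ` ?D c)"
  proof (rule stuckI[of ?R])
    show "?R \<in> cf_partitions 4 8" using ex'.exchange_cf by simp
    show "\<not> reaches_TS4 ?R" using ex'.reaches_TS4_exchange nQ by blast
    show "(`) (transpose 2 3) ` ?R 4 = T0"
      unfolding R4 by (rule equalityI) (simp_all
          add: T0_def transpose_def insert_Diff_if doubleton_eq_iff)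
  qed (simp_all del: One_nat_def
      add: Rc transpose_involution permutes_swap_id transpose_apply_other)
  from stuck_blocked[OF this d] show ?thesis
    by (simp only: blocked_image transpose_involution) (simp add: transpose_def)
qed

lemma image_Diff_singleton:
  assumes "s \<circ> s = id"
  shows "(`) s ` (E - {f}) = (`) s ` E - {s ` f}"
proof -
  have "inj s" using assms by (metis comp_id inj_on_id inj_on_imageI2)
  from image_set_diff[OF inj_image_image[OF this]] show ?thesis by simp
qed

lemma stuck_leaf_image:
  assumes s: "s \<circ> s = id" "s 2 = 2" "s 5 = a" "s 6 = b" "s 7 = t"
    and stuck: "stuck (\<lambda>c. (`) s ` C c)"
    and c: "c \<in> {1, 2, 3}" and e: "{b, t} \<in> C c" "conn (del b (C c)) t a" and d: "d \<in> {1, 2, 3}"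
  shows "blocked ((C(c := insert {a, b} (C c - {{b, t}}))) d) 2 b t"
proof -
  let ?D = "\<lambda>c. (`) s ` C c"
  have "s (s w) = w" for w using fun_cong[OF s(1), of w] by simp
  from this[of 5] this[of 6] this[of 7] have inv: "s a = 5" "s b = 6" "s t = 7"
    by (simp_all add: s(3-5))
  have "blocked ((?D(c := insert {5, 6} (?D c - {{6, 7}}))) d) 2 6 7"
    using e by (intro stuck_leaf[OF stuck c _ _ d])
      (simp_all add: s mem_image_iff conn_image_iff del_image)
  also have "(?D(c := insert {5, 6} (?D c - {{6, 7}}))) d =
      (`) s ` ((C(c := insert {a, b} (C c - {{b, t}}))) d)"
    by (simp add: image_Diff_singleton[OF s(1)] inv)
  finally show ?thesis by (simp add: blocked_image s)
qed

lemma stuck_centre_image: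
  assumes s: "s \<circ> s = id" "s 2 = 2" "s 3 = p" "s 4 = q" "s 5 = 5" "s 6 = 6"
    and stuck: "stuck (\<lambda>c. (`) s ` C c)"
    and c: "c \<in> {1, 2, 3}" and e: "{p, q} \<in> C c" "conn (del q (C c)) 2 p" and d: "d \<in> {1, 2, 3}"
  shows "blocked ((C(c := insert {2, q} (C c - {{p, q}}))) d) p 5 6"
proof -
  let ?D = "\<lambda>c. (`) s ` C c"
  have "s (s w) = w" for w using fun_cong[OF s(1), of w] by simp
  from this[of 3] this[of 4] have inv: "s p = 3" "s q = 4" by (simp_all add: s(3,4))
  have "blocked ((?D(c := insert {2, 4} (?D c - {{3, 4}}))) d) 3 5 6"
    using e by (intro stuck_centre[OF stuck c _ _ d])
      (simp_all add: s mem_image_iff conn_image_iff del_image)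
  also have "(?D(c := insert {2, 4} (?D c - {{3, 4}}))) d =
      (`) s ` ((C(c := insert {2, q} (C c - {{p, q}}))) d)"
    by (simp add: image_Diff_singleton[OF s(1)] inv s)
  finally show ?thesis by (simp add: blocked_image s)
qed

text \<open>The four cases form one orbit under the swaps of 5 with 6 and of 7 with 8, both of which
  preserve \<open>stuck\<close>.\<close>

lemma stuck_leaf_all:
  assumes "stuck C" "(a, b) \<in> {(5, 6), (6, 5)}" "t \<in> {7, 8}"
    and "c \<in> {1, 2, 3}" "{b, t} \<in> C c" "conn (del b (C c)) t a" "d \<in> {1, 2, 3}"
  shows "blocked ((C(c := insert {a, b} (C c - {{b, t}}))) d) 2 b t"
proof -
  let ?s = "transpose 5 6 \<circ> transpose 7 8 :: nat \<Rightarrow> nat"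
  have inv: "?s \<circ> ?s = id" by (simp add: fun_eq_iff transpose_def)
  have "stuck (\<lambda>c. (`) ?s ` C c)"
    using stuck_transpose_56[OF stuck_transpose_78[OF assms(1)]] by (simp
        add: image_comp image_image)
  note stucks = assms(1) this stuck_transpose_56[OF assms(1)] stuck_transpose_78[OF assms(1)]
  consider "a = 5" "b = 6" "t = 7" | "a = 5" "b = 6" "t = 8" | "a = 6" "b = 5" "t = 7"
    | "a = 6" "b = 5" "t = 8" using assms(2,3) by auto
  then show ?thesis
  proof cases
    case 1
    show ?thesis by (rule stuck_leaf_image[of id]) (use assms(4-7) stucks 1 in simp_all)
  next
    case 2
    show ?thesis by (rule stuck_leaf_image[OF transpose_involution[of 7 8]])
        (use assms(4-7) stucks 2 in \<open>simp_all add: transpose_def\<close>)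
  next
    case 3
    show ?thesis by (rule stuck_leaf_image[OF transpose_involution[of 5 6]])
        (use assms(4-7) stucks 3 in \<open>simp_all add: transpose_def\<close>)
  next
    case 4
    show ?thesis by (rule stuck_leaf_image[OF inv])
        (use assms(4-7) stucks 4 in \<open>simp_all add: transpose_def\<close>)
  qed
qed

lemma stuck_centre_all:
  assumes "stuck C" "(p, q) \<in> {(3, 4), (4, 3)}"
    and "c \<in> {1, 2, 3}" "{3, 4} \<in> C c" "conn (del q (C c)) 2 p" "d \<in> {1, 2, 3}"
  shows "blocked ((C(c := insert {2, q} (C c - {{p, q}}))) d) p 5 6"
  using assms stuck_centre_image[of id p q C c d]
    stuck_centre_image[of "transpose 3 4" p q C c d, OF transpose_involution]
    stuck_transpose_34[OF assms(1)]
  by (elim insertE) (simp_all add: transpose_def insert_commute)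

text \<open>A stuck configuration satisfies all hypotheses of \<open>three_trees_core\<close>, once
  the trees are named so that the first contains \<open>{2, 5}\<close> and the second
  \<open>{2, 6}\<close>.\<close>

lemma not_stuck: "\<not> stuck C"
proof
  assume stuck: "stuck C"
  then obtain P where P: "P \<in> cf_partitions 4 8" "P 4 = T0"
    and C: "\<And>c. c \<in> {1, 2, 3} \<Longrightarrow> C c = del 1 (P c)" by (rule stuckE) blast
  have part: "P \<in> partitions 4 8" using P by (simp add: cf_partitions_def)
  have hub: "{1, w} \<in> P 4 \<longleftrightarrow> w \<in> {2, 5, 7, 8}" for w unfolding P(2) by (rule T0_hub)
  have colour: "\<exists>c\<in>{1, 2, 3}. \<forall>d\<in>{1, 2, 3}. e \<in> C d \<longleftrightarrow> d = c"
    if e: "e \<in> complete_edges 8" "1 \<notin> e" "e \<notin> T0" for e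
  proof -
    obtain c where c: "c \<in> {1..4}" "e \<in> P c" using e(1) by (rule partitions_cover[OF part])
    then have "c \<noteq> 4" using e(3) P(2) by auto
    with c have c3: "c \<in> {1, 2, 3}" by auto
    have "e \<in> C d \<longleftrightarrow> d = c" if d: "d \<in> {1, 2, 3}" for d
    proof -
      have "d \<in> {1..4}" using d by auto
      then have "e \<in> P d \<longleftrightarrow> d = c" using partitions_disjoint[OF part _ c(1)] c(2) by blast
      then show ?thesis using C[OF d] e(2) by (simp add: del_def)
    qed
    with c3 show ?thesis by blast
  qed
  obtain i where i: "i \<in> {1, 2, 3}" "{2, 5} \<in> C i"
    using colour[of "{2, 5}"] by (auto simp: complete_edges_doubleton T0_def doubleton_eq_iff)
  obtain j where j: "j \<in> {1, 2, 3}" "{2, 6} \<in> C j"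
    using colour[of "{2, 6}"] by (auto simp: complete_edges_doubleton T0_def doubleton_eq_iff)
  \<comment> \<open>In a common tree, \<open>{2, 5}\<close> and \<open>{2, 6}\<close> would form a
    path from 5 to 6 through 2, so the goal could be reached at once.\<close>
  have "i \<noteq> j"
  proof
    assume "i = j"
    have "{2, 5} \<in> del 6 (C i)" using i(2) by (simp add: del_def)
    then have "conn (del 6 (C i)) 2 5" by (rule conn_edge)
    moreover have "{6, 2} \<in> C i" using j(2) \<open>i = j\<close> by (simp add: insert_commute)
    ultimately show False using stuck_blocked[OF stuck i(1)] by (simp add: blocked_def)
  qed
  \<comment> \<open>The remaining index, since 1 + 2 + 3 = 6.\<close>
  define k where "k = 6 - (i + j)"
  then have k: "k \<in> {1, 2, 3}" "k \<noteq> i" "k \<noteq> j"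
    using i(1) j(1) \<open>i \<noteq> j\<close> by auto
  have ijk: "{1, 2, 3} = {i, j, k}" using i(1) j(1) k \<open>i \<noteq> j\<close> by auto
  have cover: "e \<in> C i \<and> e \<notin> C j \<and> e \<notin> C k \<or> e \<notin> C i \<and> e \<in> C j \<and> e \<notin> C k \<or> e \<notin> C i \<and> e \<notin> C j \<and>
      e \<in> C k"
    if "e \<in> complete_edges 8" "1 \<notin> e" "e \<notin> T0" for e
    using colour[OF that] k \<open>i \<noteq> j\<close> unfolding ijk by auto
  have sub: "C c \<subseteq> complete_edges 8" if c: "c \<in> {1, 2, 3}" for c
  proof -
    have "c \<in> {1..4}" using c by auto
    from partitions_subset[OF part this] show ?thesis
      unfolding C[OF c] by (rule subset_trans[OF del_subset])
  qed
  have not1: "1 \<notin> e" if "c \<in> {1, 2, 3}" "e \<in> C c" for c e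
    using that(2) by (simp add: C[OF that(1)] del_def)
  have tree: "e \<notin> C c" if "e \<in> T0" "c \<in> {1, 2, 3}" for e c
  proof
    assume "e \<in> C c"
    then have "e \<in> P c" by (simp add: C[OF that(2)] del_def)
    then have "c = 4" using partitions_disjoint[OF part, of c 4 e] that P(2) by auto
    with that(2) show False by simp
  qed
  \<comment> \<open>The update of \<open>C\<close> at \<open>c\<close> leaves the other two trees of
    the triple alone, because their indices differ from \<open>c\<close>.\<close>
  have triple: "\<exists>c d d'. E = C c \<and> F = C d \<and> G = C d' \<and> {c, d, d'} \<subseteq> {1, 2, 3} \<and> c \<noteq> d \<and> c \<noteq> d'"
    if "(E, F, G) \<in> {(C i, C j, C k), (C j, C k, C i), (C k, C i, C j)}" for E F G
    using that k \<open>i \<noteq> j\<close> unfolding ijk by blast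
  show False
  proof (rule three_trees_core[of "C i" "C j" "C k"])
    fix E assume "E \<in> {C i, C j, C k}"
    then obtain c where c: "c \<in> {1, 2, 3}" "E = C c" unfolding ijk by blast
    show "\<Union>E \<subseteq> {2, 3, 4, 5, 6, 7, 8}"
    proof
      fix x assume "x \<in> \<Union>E"
      then obtain e where e: "x \<in> e" "e \<in> C c" using c by blast
      then have "e \<subseteq> {1..8}" "1 \<notin> e" using sub[OF c(1)] not1[OF c(1)]
          by (auto simp: complete_edges_eq)
      then have "x \<in> {1..8}" "x \<noteq> 1" using e(1) by auto
      then show "x \<in> {2, 3, 4, 5, 6, 7, 8}" by auto
    qed
    show "blocked E 2 5 6" unfolding c(2) using stuck c(1) by (rule stuck_blocked)
    fix x y :: nat assume "x \<in> {2, 3, 4, 5, 6, 7, 8}" "y \<in> {2, 3, 4, 5, 6, 7, 8}"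
    then show "conn E x y"
      unfolding c(2) C[OF c(1)] by (intro conn_del_hub[OF P(1) hub c(1)]) auto
  next
    fix E F G a b t X
    assume "(E, F, G) \<in> {(C i, C j, C k), (C j, C k, C i), (C k, C i, C j)}"
      and abt: "(a, b) \<in> {(5, 6), (6, 5)}" "t \<in> {7, 8}" and e: "{b, t} \<in> E" "conn (del b E) t a"
      and X: "X \<in> {insert {a, b} (E - {{b, t}}), F, G}"
    from triple[OF this(1)] obtain c d d' where c: "E = C c" "F = C d" "G = C d'"
      "{c, d, d'} \<subseteq> {1, 2, 3}" "c \<noteq> d" "c \<noteq> d'" by blast
    show "blocked X 2 b t"
      using stuck_leaf_all[OF stuck abt, of c] X e c by (elim insertE) force+
  next
    fix E F G p q X
    assume "(E, F, G) \<in> {(C i, C j, C k), (C j, C k, C i), (C k, C i, C j)}"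
      and pq: "(p, q) \<in> {(3, 4), (4, 3)}" and e: "{3, 4} \<in> E" "conn (del q E) 2 p"
      and X: "X \<in> {insert {2, q} (E - {{p, q}}), F, G}"
    from triple[OF this(1)] obtain c d d' where c: "E = C c" "F = C d" "G = C d'"
      "{c, d, d'} \<subseteq> {1, 2, 3}" "c \<noteq> d" "c \<noteq> d'" by blast
    show "blocked X p 5 6"
      using stuck_centre_all[OF stuck pq, of c] X e c by (elim insertE) force+
  next
    show "{2, 5} \<in> C i" "{2, 6} \<in> C j" by fact+
  next
    show "\<forall>e\<in>{{2, 3}, {2, 4}, {5, 6}}. e \<notin> C i \<and> e \<notin> C j \<and> e \<notin> C k"
      using tree i(1) j(1) k(1) by (auto simp: T0_def)
  qed (intro ballI cover; auto simp: complete_edges_doubleton T0_def doubleton_eq_iff)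
qed

section \<open>Passing to the normal form of the fourth tree\<close>

lemma graph_isomorphic_permutation:
  assumes "graph_isomorphic n E F" "E \<subseteq> complete_edges n" "F \<subseteq> complete_edges n"
  shows "\<exists>s. s permutes {1..n} \<and> (`) s ` E = F"
proof -
  obtain f where f: "bij_betw f {1..n} {1..n}"
    "\<forall>i\<in>{1..n}. \<forall>j\<in>{1..n}. {i, j} \<in> E \<longleftrightarrow> {f i, f j} \<in> F"
    using assms(1) unfolding graph_isomorphic_def by blast
  \<comment> \<open>Extending \<open>f\<close> by the identity gives a permutation in the sense of
    \<open>permutes\<close> without changing it on the vertices.\<close>
  let ?s = "\<lambda>x. if x \<in> {1..n} then f x else x"
  have "bij_betw ?s {1..n} {1..n} \<longleftrightarrow> bij_betw f {1..n} {1..n}"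
    by (rule bij_betw_cong) simp
  with f(1) have "bij_betw ?s {1..n} {1..n}" by blast
  then have "?s permutes {1..n}" by (rule bij_imp_permutes) (rule if_not_P)
  moreover have "(`) ?s ` E = F"
  proof (intro equalityI subsetI)
    fix e assume "e \<in> (`) ?s ` E"
    then obtain e' where e': "e' \<in> E" "e = ?s ` e'" by blast
    then obtain a b where "e' = {a, b}" "a \<in> {1..n}" "b \<in> {1..n}"
      using assms(2) complete_edgesE by (metis subsetD)
    then show "e \<in> F" using f(2) e' by simp
  next
    fix e assume e: "e \<in> F"
    then obtain a b where ab: "e = {a, b}" "a \<in> {1..n}" "b \<in> {1..n}"
      using assms(3) complete_edgesE by (metis subsetD)
    then obtain i j where ij: "i \<in> {1..n}" "j \<in> {1..n}" "a = f i" "b = f j"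
      using f(1) by (metis bij_betw_imp_surj_on imageE)
    then have "{i, j} \<in> E" using f(2) e ab by simp
    moreover have "e = ?s ` {i, j}" using ij ab by simp
    ultimately show "e \<in> (`) ?s ` E" by blast
  qed
  ultimately show ?thesis by blast
qed

lemma T19_isomorphic_T0: "graph_isomorphic 8 T19 T0"
proof -
  \<comment> \<open>The vertices 4 and 3 of degrees four and three go to 1 and 2, and the path 4, 7,
    8 goes to 1, 5, 6; entry 0 is padding, as vertices start at 1.\<close>
  let ?f = "\<lambda>x. [0, 3, 4, 2, 1, 7, 8, 5, 6] ! x :: nat"
  have "bij_betw ?f {1..8} {1..8}"
    unfolding vertices_8 by
        (rule bij_betw_byWitness[of _ "\<lambda>x. [0, 4, 3, 1, 2, 7, 8, 5, 6] ! x"]) simp_all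
  then show ?thesis
    unfolding graph_isomorphic_def vertices_8
    by (intro exI[of _ ?f]) (simp add: T19_def T0_def doubleton_eq_iff)
qed

theorem lemma4p5:
  fixes \<Gamma> :: "nat \<Rightarrow> nat set set"
  assumes "\<Gamma> \<in> cf_partitions 4 8"
    and "graph_isomorphic 8 (\<Gamma> 4) T19"
  shows "\<exists>\<Delta> \<in> cf_partitions 4 8.
           graph_isomorphic 8 (\<Delta> 4) TS4 \<and> weakly_equivalent 4 \<Gamma> \<Delta>"
proof -
  have "\<Gamma> 4 \<subseteq> complete_edges 8"
    using assms(1) partitions_subset[of \<Gamma> 4 8 4] by (simp add: cf_partitions_def)
  moreover have T19: "T19 \<subseteq> complete_edges 8" and T0: "T0 \<subseteq> complete_edges 8"
    by (simp_all add: T19_def T0_def complete_edges_doubleton)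
  ultimately obtain s where s: "s permutes {1..8}" "(`) s ` \<Gamma> 4 = T19"
    using graph_isomorphic_permutation[OF assms(2)] by blast
  obtain t where t: "t permutes {1..8}" "(`) t ` T19 = T0"
    using graph_isomorphic_permutation[OF T19_isomorphic_T0 T19 T0] by blast
  let ?P = "vertex_action 4 t (vertex_action 4 s \<Gamma>)"
  have P: "?P \<in> cf_partitions 4 8"
    by (intro vertex_action_cf assms(1) s(1) t(1))
  have "?P 4 = T0" by (simp add: vertex_action_def s(2) t(2))
  \<comment> \<open>If this normal form did not reach \<open>TS4\<close>, its trees without vertex 1
    would be \<open>stuck\<close>.\<close>
  with P not_stuck[of "\<lambda>c. del 1 (?P c)"] have "reaches_TS4 ?P"
    unfolding stuck_def by blast
  then have "reaches_TS4 \<Gamma>"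
    using reaches_TS4_relabel vertex_action_cf assms(1) s(1) t(1) by blast
  then show ?thesis by (rule reaches_TS4D)
qed

end
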